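(* Let $X$ be a set. The free Ehresmann monoid $FEM(X)$ and the free Ehresmann semigroup $FES(X)$ are proper.
   Context: **Ehresmann semigroups.** An Ehresmann semigroup is an algebra $(S;\cdot\,,{}^+,{}^* )$ with $(S;\cdot)$ a semigroup and unary operations ${}^+,{}^*$ satisfying $x^+x=x$, $(x^+y^+)^+=x^+y^+=y^+x^+$, $(xy)^+=(xy^+)^+$, $xx^*=x$, $(x^*y^* )^*=x^*y^*=y^*x^*$, $(xy)^*=(x^*y)^*$, $(x^+)^*=x^+$, $(x^* )^+=x^*$. An Ehresmann monoid is an Ehresmann semigroup possessing an identity element (regarded as a constant, so the signature is $(2,1,1,0)$). $FES(X)$ and $FEM(X)$ are the free $X$-generated objects in the varieties of Ehresmann semigroups (signature $(2,1,1)$) and Ehresmann monoids (signature $(2,1,1,0)$), respectively. $P(S)=\{s^+\colon s\in S\}=\{s^*\colon s\in S\}$ is the semilattice of projections. The natural partial order: $a\leq b$ iff $a=ebf$ for some $e,f\in P(S)$. $\sigma$ is the minimum congruence on $S$ identifying all elements of $P(S)$. **Proper Ehresmann semigroups.** A matching factorization of $s\in S$ is a tuple $(s_1,\dots,s_n)$ of elements of $S$, $n\ge1$, with $s=s_1\cdots s_n$ and $s_i^*=s_{i+1}^+$ for $1\le i\le n-1$. An element $s$ is proper if for all $t\in S$: $t^+=s^+$, $t^*=s^*$ and $t\mathrel{\sigma}s$ imply $t=s$. A matching factorization $(s_1,\dots,s_n)$ is into a product of proper elements (respectively of elements of a subset $Y\subseteq S$) if all $s_i$ are proper (respectively belong to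 $Y$). If $(s_1,\dots,s_n)$ is a matching factorization of $s$ into a product of proper elements and $i\le j$ are such that $t=s_i\cdots s_j$ is a proper element of $S$, then $(s_1,\dots,s_{i-1},t,s_{j+1},\dots,s_n)$ is also a matching factorization of $s$ into a product of proper elements, and one writes $(s_1,\dots,s_n)\to(s_1,\dots,s_{i-1},t,s_{j+1},\dots,s_n)$. Two matching factorizations of $s$ into products of proper elements are equivalent if one can be obtained from the other by finitely many applications of the relation $\to$ or its inverse. $S$ is proper if it has an order ideal $Y$ with respect to $\leq$ such that $P(S)\subseteq Y$, all elements of $Y$ are proper, and each $s\in S$ admits a unique, up to equivalence, matching factorization as a product of elements of $Y$. *)

theory Defs
  imports Main
begin

section \<open>Ehresmann semigroups and monoids\<close>

text \<open>Carriers are allowed to be empty, so that the variety of Ehresmann semigroups has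
  a free object over the empty set.\<close>

record 'a biunary_semigroup =
  carrier :: "'a set"
  mult :: "'a \<Rightarrow> 'a \<Rightarrow> 'a"  (infixl "\<odot>\<index>" 70)
  pluss :: "'a \<Rightarrow> 'a"  ("_\<^sup>\<oplus>\<index>" [1000] 999)
  starr :: "'a \<Rightarrow> 'a"  ("_\<^sup>\<star>\<index>" [1000] 999)

record 'a biunary_monoid = "'a biunary_semigroup" +
  unit :: 'a  ("\<e>\<index>")

locale ehresmann_semigroup =
  fixes S :: "('a, 'm) biunary_semigroup_scheme" (structure)
  assumes mult_closed: "\<lbrakk>x \<in> carrier S; y \<in> carrier S\<rbrakk> \<Longrightarrow> x \<odot> y \<in> carrier S"
    and pluss_closed: "x \<in> carrier S \<Longrightarrow> x\<^sup>\<oplus> \<in> carrier S"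
    and starr_closed: "x \<in> carrier S \<Longrightarrow> x\<^sup>\<star> \<in> carrier S"
    and assoc: "\<lbrakk>x \<in> carrier S; y \<in> carrier S; z \<in> carrier S\<rbrakk> \<Longrightarrow> (x \<odot> y) \<odot> z = x \<odot> (y \<odot> z)"
    and pluss_left: "x \<in> carrier S \<Longrightarrow> x\<^sup>\<oplus> \<odot> x = x"
    and pluss_pluss: "\<lbrakk>x \<in> carrier S; y \<in> carrier S\<rbrakk> \<Longrightarrow> (x\<^sup>\<oplus> \<odot> y\<^sup>\<oplus>)\<^sup>\<oplus> = x\<^sup>\<oplus> \<odot> y\<^sup>\<oplus>"
    and pluss_commute: "\<lbrakk>x \<in> carrier S; y \<in> carrier S\<rbrakk> \<Longrightarrow> x\<^sup>\<oplus> \<odot> y\<^sup>\<oplus> = y\<^sup>\<oplus> \<odot> x\<^sup>\<oplus>"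
    and pluss_mult: "\<lbrakk>x \<in> carrier S; y \<in> carrier S\<rbrakk> \<Longrightarrow> (x \<odot> y)\<^sup>\<oplus> = (x \<odot> y\<^sup>\<oplus>)\<^sup>\<oplus>"
    and starr_right: "x \<in> carrier S \<Longrightarrow> x \<odot> x\<^sup>\<star> = x"
    and starr_starr: "\<lbrakk>x \<in> carrier S; y \<in> carrier S\<rbrakk> \<Longrightarrow> (x\<^sup>\<star> \<odot> y\<^sup>\<star>)\<^sup>\<star> = x\<^sup>\<star> \<odot> y\<^sup>\<star>"
    and starr_commute: "\<lbrakk>x \<in> carrier S; y \<in> carrier S\<rbrakk> \<Longrightarrow> x\<^sup>\<star> \<odot> y\<^sup>\<star> = y\<^sup>\<star> \<odot> x\<^sup>\<star>"
    and starr_mult: "\<lbrakk>x \<in> carrier S; y \<in> carrier S\<rbrakk> \<Longrightarrow> (x \<odot> y)\<^sup>\<star> = (x\<^sup>\<star> \<odot> y)\<^sup>\<star>"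
    and pluss_starr: "x \<in> carrier S \<Longrightarrow> (x\<^sup>\<oplus>)\<^sup>\<star> = x\<^sup>\<oplus>"
    and starr_pluss: "x \<in> carrier S \<Longrightarrow> (x\<^sup>\<star>)\<^sup>\<oplus> = x\<^sup>\<star>"

locale ehresmann_monoid = ehresmann_semigroup S
  for S :: "('a, 'm) biunary_monoid_scheme" (structure) +
  assumes unit_closed: "\<e> \<in> carrier S"
    and unit_left: "x \<in> carrier S \<Longrightarrow> \<e> \<odot> x = x"
    and unit_right: "x \<in> carrier S \<Longrightarrow> x \<odot> \<e> = x"

section \<open>Congruences and quotients\<close>

definition is_congruence :: "('a, 'm) biunary_semigroup_scheme \<Rightarrow> ('a \<times> 'a) set \<Rightarrow> bool" where
  "is_congruence S r \<longleftrightarrow> equiv (carrier S) r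
     \<and> (\<forall>a b c d. (a, b) \<in> r \<longrightarrow> (c, d) \<in> r \<longrightarrow> (a \<odot>\<^bsub>S\<^esub> c, b \<odot>\<^bsub>S\<^esub> d) \<in> r)
     \<and> (\<forall>a b. (a, b) \<in> r \<longrightarrow> (a\<^sup>\<oplus>\<^bsub>S\<^esub>, b\<^sup>\<oplus>\<^bsub>S\<^esub>) \<in> r)
     \<and> (\<forall>a b. (a, b) \<in> r \<longrightarrow> (a\<^sup>\<star>\<^bsub>S\<^esub>, b\<^sup>\<star>\<^bsub>S\<^esub>) \<in> r)"

definition quot :: "('a, 'm) biunary_semigroup_scheme \<Rightarrow> ('a \<times> 'a) set \<Rightarrow> 'a set biunary_semigroup" where
  "quot S r = \<lparr>carrier = carrier S // r,
     mult = (\<lambda>A B. \<Union>a\<in>A. \<Union>b\<in>B. r `` {a \<odot>\<^bsub>S\<^esub> b}),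
     pluss = (\<lambda>A. \<Union>a\<in>A. r `` {a\<^sup>\<oplus>\<^bsub>S\<^esub>}),
     starr = (\<lambda>A. \<Union>a\<in>A. r `` {a\<^sup>\<star>\<^bsub>S\<^esub>})\<rparr>"

definition quot_monoid :: "('a, 'm) biunary_monoid_scheme \<Rightarrow> ('a \<times> 'a) set \<Rightarrow> 'a set biunary_monoid" where
  "quot_monoid S r = \<lparr>carrier = carrier (quot S r), mult = mult (quot S r),
     pluss = pluss (quot S r), starr = starr (quot S r), unit = r `` {\<e>\<^bsub>S\<^esub>}\<rparr>"

section \<open>Free Ehresmann semigroups and monoids\<close>

text \<open>The free \<open>X\<close>-generated object of a variety is the quotient of the term algebra over \<open>X\<close>
  by the intersection of all congruences whose quotient lies in the variety.
  The universal properties are proved at the end of this theory.\<close>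

datatype 'a sterm = SGen 'a | SMult "'a sterm" "'a sterm" | SPlus "'a sterm" | SStar "'a sterm"

definition sterm_algebra :: "'a set \<Rightarrow> 'a sterm biunary_semigroup" where
  "sterm_algebra X = \<lparr>carrier = {t. set_sterm t \<subseteq> X}, mult = SMult, pluss = SPlus, starr = SStar\<rparr>"

definition FES_congruence :: "'a set \<Rightarrow> ('a sterm \<times> 'a sterm) set" where
  "FES_congruence X = \<Inter>{r. is_congruence (sterm_algebra X) r
     \<and> ehresmann_semigroup (quot (sterm_algebra X) r)}"

definition FES :: "'a set \<Rightarrow> 'a sterm set biunary_semigroup" where
  "FES X = quot (sterm_algebra X) (FES_congruence X)"

datatype 'a mterm = MGen 'a | MUnit | MMult "'a mterm" "'a mterm" | MPlus "'a mterm" | MStar "'a mterm"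

definition mterm_algebra :: "'a set \<Rightarrow> 'a mterm biunary_monoid" where
  "mterm_algebra X = \<lparr>carrier = {t. set_mterm t \<subseteq> X}, mult = MMult, pluss = MPlus, starr = MStar,
     unit = MUnit\<rparr>"

definition FEM_congruence :: "'a set \<Rightarrow> ('a mterm \<times> 'a mterm) set" where
  "FEM_congruence X = \<Inter>{r. is_congruence (mterm_algebra X) r
     \<and> ehresmann_monoid (quot_monoid (mterm_algebra X) r)}"

definition FEM :: "'a set \<Rightarrow> 'a mterm set biunary_monoid" where
  "FEM X = quot_monoid (mterm_algebra X) (FEM_congruence X)"

section \<open>Proper Ehresmann semigroups\<close>

definition projections :: "('a, 'm) biunary_semigroup_scheme \<Rightarrow> 'a set" where
  "projections S = {s\<^sup>\<oplus>\<^bsub>S\<^esub> | s. s \<in> carrier S}"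

definition natural_le :: "('a, 'm) biunary_semigroup_scheme \<Rightarrow> 'a \<Rightarrow> 'a \<Rightarrow> bool" where
  "natural_le S a b \<longleftrightarrow> (\<exists>e\<in>projections S. \<exists>f\<in>projections S. a = e \<odot>\<^bsub>S\<^esub> b \<odot>\<^bsub>S\<^esub> f)"

definition order_ideal :: "('a, 'm) biunary_semigroup_scheme \<Rightarrow> 'a set \<Rightarrow> bool" where
  "order_ideal S Y \<longleftrightarrow> Y \<subseteq> carrier S
     \<and> (\<forall>a\<in>carrier S. \<forall>b\<in>Y. natural_le S a b \<longrightarrow> a \<in> Y)"

definition sigma :: "('a, 'm) biunary_semigroup_scheme \<Rightarrow> ('a \<times> 'a) set" where
  "sigma S = \<Inter>{r. is_congruence S r \<and> projections S \<times> projections S \<subseteq> r}"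

definition proper_element :: "('a, 'm) biunary_semigroup_scheme \<Rightarrow> 'a \<Rightarrow> bool" where
  "proper_element S s \<longleftrightarrow> s \<in> carrier S
     \<and> (\<forall>t\<in>carrier S. t\<^sup>\<oplus>\<^bsub>S\<^esub> = s\<^sup>\<oplus>\<^bsub>S\<^esub> \<longrightarrow> t\<^sup>\<star>\<^bsub>S\<^esub> = s\<^sup>\<star>\<^bsub>S\<^esub> \<longrightarrow> (t, s) \<in> sigma S \<longrightarrow> t = s)"

text \<open>There is no empty product in a semigroup; the value at \<open>[]\<close> is never used.\<close>

fun list_mult :: "('a, 'm) biunary_semigroup_scheme \<Rightarrow> 'a list \<Rightarrow> 'a" where
  "list_mult S [] = undefined"
| "list_mult S [x] = x"
| "list_mult S (x # y # zs) = x \<odot>\<^bsub>S\<^esub> list_mult S (y # zs)"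

definition matching_factorization ::
  "('a, 'm) biunary_semigroup_scheme \<Rightarrow> 'a set \<Rightarrow> 'a \<Rightarrow> 'a list \<Rightarrow> bool" where
  "matching_factorization S Y s xs \<longleftrightarrow> xs \<noteq> [] \<and> set xs \<subseteq> carrier S \<inter> Y \<and> s = list_mult S xs
     \<and> successively (\<lambda>a b. a\<^sup>\<star>\<^bsub>S\<^esub> = b\<^sup>\<oplus>\<^bsub>S\<^esub>) xs"

abbreviation proper_factorization ::
  "('a, 'm) biunary_semigroup_scheme \<Rightarrow> 'a \<Rightarrow> 'a list \<Rightarrow> bool" where
  "proper_factorization S s xs \<equiv> matching_factorization S {t. proper_element S t} s xs"

inductive reduces :: "('a, 'm) biunary_semigroup_scheme \<Rightarrow> 'a \<Rightarrow> 'a list \<Rightarrow> 'a list \<Rightarrow> bool"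
  for S s where
  "\<lbrakk>proper_factorization S s (us @ vs @ ws); vs \<noteq> []; proper_element S (list_mult S vs)\<rbrakk>
     \<Longrightarrow> reduces S s (us @ vs @ ws) (us @ [list_mult S vs] @ ws)"

definition proper_semigroup :: "('a, 'm) biunary_semigroup_scheme \<Rightarrow> bool" where
  "proper_semigroup S \<longleftrightarrow> ehresmann_semigroup S
     \<and> (\<exists>Y. order_ideal S Y \<and> projections S \<subseteq> Y \<and> (\<forall>y\<in>Y. proper_element S y)
          \<and> (\<forall>s\<in>carrier S. (\<exists>xs. matching_factorization S Y s xs)
               \<and> (\<forall>xs ys. matching_factorization S Y s xs \<longrightarrow> matching_factorization S Y s ys
                    \<longrightarrow> equivclp (reduces S s) xs ys)))"

section \<open>Universal properties\<close>

definition is_hom ::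
  "('a, 'm) biunary_semigroup_scheme \<Rightarrow> ('b, 'n) biunary_semigroup_scheme \<Rightarrow> ('a \<Rightarrow> 'b) \<Rightarrow> bool" where
  "is_hom S T h \<longleftrightarrow> (\<forall>x\<in>carrier S. h x \<in> carrier T)
     \<and> (\<forall>x\<in>carrier S. \<forall>y\<in>carrier S. h (x \<odot>\<^bsub>S\<^esub> y) = h x \<odot>\<^bsub>T\<^esub> h y)
     \<and> (\<forall>x\<in>carrier S. h (x\<^sup>\<oplus>\<^bsub>S\<^esub>) = (h x)\<^sup>\<oplus>\<^bsub>T\<^esub>)
     \<and> (\<forall>x\<in>carrier S. h (x\<^sup>\<star>\<^bsub>S\<^esub>) = (h x)\<^sup>\<star>\<^bsub>T\<^esub>)"

definition FES_gen :: "'a set \<Rightarrow> 'a \<Rightarrow> 'a sterm set" where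
  "FES_gen X x = FES_congruence X `` {SGen x}"

definition FEM_gen :: "'a set \<Rightarrow> 'a \<Rightarrow> 'a mterm set" where
  "FEM_gen X x = FEM_congruence X `` {MGen x}"

definition closed_carrier :: "('a, 'm) biunary_semigroup_scheme \<Rightarrow> bool" where
  "closed_carrier S \<longleftrightarrow> (\<forall>x\<in>carrier S. \<forall>y\<in>carrier S. x \<odot>\<^bsub>S\<^esub> y \<in> carrier S)
     \<and> (\<forall>x\<in>carrier S. x\<^sup>\<oplus>\<^bsub>S\<^esub> \<in> carrier S) \<and> (\<forall>x\<in>carrier S. x\<^sup>\<star>\<^bsub>S\<^esub> \<in> carrier S)"

lemma closed_sterm: "closed_carrier (sterm_algebra X)"
  and closed_mterm: "closed_carrier (mterm_algebra X)"
  by (auto simp: closed_carrier_def sterm_algebra_def mterm_algebra_def)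

lemma quot_simps:
  assumes r: "is_congruence S r"
  shows "carrier (quot S r) = carrier S // r"
    and "\<lbrakk>a \<in> carrier S; b \<in> carrier S\<rbrakk> \<Longrightarrow> r `` {a} \<odot>\<^bsub>quot S r\<^esub> r `` {b} = r `` {a \<odot>\<^bsub>S\<^esub> b}"
    and "a \<in> carrier S \<Longrightarrow> (r `` {a})\<^sup>\<oplus>\<^bsub>quot S r\<^esub> = r `` {a\<^sup>\<oplus>\<^bsub>S\<^esub>}"
    and "a \<in> carrier S \<Longrightarrow> (r `` {a})\<^sup>\<star>\<^bsub>quot S r\<^esub> = r `` {a\<^sup>\<star>\<^bsub>S\<^esub>}"
proof -
  have e: "equiv (carrier S) r" using r by (simp add: is_congruence_def)
  note eq = equiv_class_eq[OF e]
  show "carrier (quot S r) = carrier S // r" by (simp add: quot_def)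
  have "congruent2 r r (\<lambda>a b. r `` {a \<odot>\<^bsub>S\<^esub> b})"
    using r by (auto simp: is_congruence_def congruent2_def intro!: eq)
  from UN_equiv_class2[OF e e this]
  show "\<lbrakk>a \<in> carrier S; b \<in> carrier S\<rbrakk> \<Longrightarrow> r `` {a} \<odot>\<^bsub>quot S r\<^esub> r `` {b} = r `` {a \<odot>\<^bsub>S\<^esub> b}"
    by (simp add: quot_def)
  have "(\<lambda>a. r `` {a\<^sup>\<oplus>\<^bsub>S\<^esub>}) respects r" using r by (auto simp: is_congruence_def congruent_def intro!: eq)
  from UN_equiv_class[OF e this]
  show "a \<in> carrier S \<Longrightarrow> (r `` {a})\<^sup>\<oplus>\<^bsub>quot S r\<^esub> = r `` {a\<^sup>\<oplus>\<^bsub>S\<^esub>}" by (simp add: quot_def)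
  have "(\<lambda>a. r `` {a\<^sup>\<star>\<^bsub>S\<^esub>}) respects r" using r by (auto simp: is_congruence_def congruent_def intro!: eq)
  from UN_equiv_class[OF e this]
  show "a \<in> carrier S \<Longrightarrow> (r `` {a})\<^sup>\<star>\<^bsub>quot S r\<^esub> = r `` {a\<^sup>\<star>\<^bsub>S\<^esub>}" by (simp add: quot_def)
qed

definition ehresmann_identities_at ::
  "('a, 'm) biunary_semigroup_scheme \<Rightarrow> 'a \<Rightarrow> 'a \<Rightarrow> 'a \<Rightarrow> ('a \<times> 'a) set" where
  "ehresmann_identities_at S x y z =
     {((x \<odot>\<^bsub>S\<^esub> y) \<odot>\<^bsub>S\<^esub> z, x \<odot>\<^bsub>S\<^esub> (y \<odot>\<^bsub>S\<^esub> z)),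
      (x\<^sup>\<oplus>\<^bsub>S\<^esub> \<odot>\<^bsub>S\<^esub> x, x),
      ((x\<^sup>\<oplus>\<^bsub>S\<^esub> \<odot>\<^bsub>S\<^esub> y\<^sup>\<oplus>\<^bsub>S\<^esub>)\<^sup>\<oplus>\<^bsub>S\<^esub>, x\<^sup>\<oplus>\<^bsub>S\<^esub> \<odot>\<^bsub>S\<^esub> y\<^sup>\<oplus>\<^bsub>S\<^esub>),
      (x\<^sup>\<oplus>\<^bsub>S\<^esub> \<odot>\<^bsub>S\<^esub> y\<^sup>\<oplus>\<^bsub>S\<^esub>, y\<^sup>\<oplus>\<^bsub>S\<^esub> \<odot>\<^bsub>S\<^esub> x\<^sup>\<oplus>\<^bsub>S\<^esub>),
      ((x \<odot>\<^bsub>S\<^esub> y)\<^sup>\<oplus>\<^bsub>S\<^esub>, (x \<odot>\<^bsub>S\<^esub> y\<^sup>\<oplus>\<^bsub>S\<^esub>)\<^sup>\<oplus>\<^bsub>S\<^esub>),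
      (x \<odot>\<^bsub>S\<^esub> x\<^sup>\<star>\<^bsub>S\<^esub>, x),
      ((x\<^sup>\<star>\<^bsub>S\<^esub> \<odot>\<^bsub>S\<^esub> y\<^sup>\<star>\<^bsub>S\<^esub>)\<^sup>\<star>\<^bsub>S\<^esub>, x\<^sup>\<star>\<^bsub>S\<^esub> \<odot>\<^bsub>S\<^esub> y\<^sup>\<star>\<^bsub>S\<^esub>),
      (x\<^sup>\<star>\<^bsub>S\<^esub> \<odot>\<^bsub>S\<^esub> y\<^sup>\<star>\<^bsub>S\<^esub>, y\<^sup>\<star>\<^bsub>S\<^esub> \<odot>\<^bsub>S\<^esub> x\<^sup>\<star>\<^bsub>S\<^esub>),
      ((x \<odot>\<^bsub>S\<^esub> y)\<^sup>\<star>\<^bsub>S\<^esub>, (x\<^sup>\<star>\<^bsub>S\<^esub> \<odot>\<^bsub>S\<^esub> y)\<^sup>\<star>\<^bsub>S\<^esub>),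
      ((x\<^sup>\<oplus>\<^bsub>S\<^esub>)\<^sup>\<star>\<^bsub>S\<^esub>, x\<^sup>\<oplus>\<^bsub>S\<^esub>),
      ((x\<^sup>\<star>\<^bsub>S\<^esub>)\<^sup>\<oplus>\<^bsub>S\<^esub>, x\<^sup>\<star>\<^bsub>S\<^esub>)}"

definition ehresmann_identities :: "('a, 'm) biunary_semigroup_scheme \<Rightarrow> ('a \<times> 'a) set" where
  "ehresmann_identities S =
     (\<Union>x\<in>carrier S. \<Union>y\<in>carrier S. \<Union>z\<in>carrier S. ehresmann_identities_at S x y z)"

lemma ball_quotient: "(\<forall>A\<in>C // r. Q A) \<longleftrightarrow> (\<forall>a\<in>C. Q (r `` {a}))"
  by (auto simp: quotient_def)

lemma ehresmann_semigroup_quot_iff: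
  assumes r: "is_congruence S r" and c: "closed_carrier S"
  shows "ehresmann_semigroup (quot S r) \<longleftrightarrow> ehresmann_identities S \<subseteq> r"
proof -
  have e: "equiv (carrier S) r" using r by (simp add: is_congruence_def)
  have cl: "\<And>x y. \<lbrakk>x \<in> carrier S; y \<in> carrier S\<rbrakk> \<Longrightarrow> x \<odot>\<^bsub>S\<^esub> y \<in> carrier S"
    "\<And>x. x \<in> carrier S \<Longrightarrow> x\<^sup>\<oplus>\<^bsub>S\<^esub> \<in> carrier S" "\<And>x. x \<in> carrier S \<Longrightarrow> x\<^sup>\<star>\<^bsub>S\<^esub> \<in> carrier S"
    using c by (auto simp: closed_carrier_def)
  note q = quot_simps[OF r] cl eq_equiv_class_iff[OF e] quotientI[of _ "carrier S" r]
  let ?Q = "quot S r"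
  show ?thesis
  proof
    assume "ehresmann_semigroup ?Q"
    then interpret Q: ehresmann_semigroup ?Q .
    have m: "r `` {a} \<in> carrier ?Q" if "a \<in> carrier S" for a
      using that by (simp add: q)
    show "ehresmann_identities S \<subseteq> r"
    proof
      fix p assume "p \<in> ehresmann_identities S"
      then obtain x y z where xyz: "x \<in> carrier S" "y \<in> carrier S" "z \<in> carrier S"
        and p: "p \<in> ehresmann_identities_at S x y z"
        by (auto simp: ehresmann_identities_def)
      note i = Q.assoc[OF m m m] Q.pluss_left[OF m] Q.pluss_pluss[OF m m] Q.pluss_commute[OF m m]
        Q.pluss_mult[OF m m] Q.starr_right[OF m] Q.starr_starr[OF m m] Q.starr_commute[OF m m]
        Q.starr_mult[OF m m] Q.pluss_starr[OF m] Q.starr_pluss[OF m]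
      show "p \<in> r"
        using p i(1)[OF xyz] i(2)[OF xyz(1)] i(3)[OF xyz(1,2)] i(4)[OF xyz(1,2)] i(5)[OF xyz(1,2)]
          i(6)[OF xyz(1)] i(7)[OF xyz(1,2)] i(8)[OF xyz(1,2)] i(9)[OF xyz(1,2)] i(10)[OF xyz(1)] i(11)[OF xyz(1)]
        by (simp add: q xyz ehresmann_identities_at_def) (elim disjE; simp)
    qed
  next
    assume "ehresmann_identities S \<subseteq> r"
    then have i: "p \<in> r" if "p \<in> ehresmann_identities_at S x y z"
      "x \<in> carrier S" "y \<in> carrier S" "z \<in> carrier S" for p x y z
      using that unfolding ehresmann_identities_def by blast
    have j: "ehresmann_identities_at S x y z \<subseteq> r"
      if "x \<in> carrier S" "y \<in> carrier S" "z \<in> carrier S" for x y z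
      using i that by blast
    show "ehresmann_semigroup ?Q"
      by (unfold_locales; unfold quot_simps(1)[OF r]; elim quotientE;
          simp add: q j[unfolded ehresmann_identities_at_def, simplified])
  qed
qed

lemma is_congruence_Inter:
  assumes "\<And>r. r \<in> R \<Longrightarrow> is_congruence S r" and "R \<noteq> {}"
  shows "is_congruence S (\<Inter>R)"
proof -
  have "equiv (carrier S) (\<Inter>R)"
  proof (rule equivI)
    show "\<Inter>R \<subseteq> carrier S \<times> carrier S" "refl_on (carrier S) (\<Inter>R)"
      using assms by (fastforce simp: is_congruence_def equiv_def refl_on_def)+
    show "sym (\<Inter>R)" using assms by (fastforce simp: is_congruence_def equiv_def sym_def)
    show "trans (\<Inter>R)"
    proof (rule transI, rule InterI)
      fix x y z r assume "(x, y) \<in> \<Inter>R" "(y, z) \<in> \<Inter>R" "r \<in> R"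
      with assms(1)[of r] show "(x, z) \<in> r"
        by (auto simp: is_congruence_def equiv_def dest: transD)
    qed
  qed
  then show ?thesis using assms(1) unfolding is_congruence_def by blast
qed

lemma is_congruence_total: "closed_carrier S \<Longrightarrow> is_congruence S (carrier S \<times> carrier S)"
  by (auto simp: is_congruence_def closed_carrier_def equiv_def refl_on_def sym_def trans_def)

lemma ehresmann_identities_carrier:
  "closed_carrier S \<Longrightarrow> ehresmann_identities S \<subseteq> carrier S \<times> carrier S"
  unfolding ehresmann_identities_def ehresmann_identities_at_def closed_carrier_def by auto

lemma FES_congruence_alt:
  "FES_congruence X = \<Inter>{r. is_congruence (sterm_algebra X) r \<and> ehresmann_identities (sterm_algebra X) \<subseteq> r}"
  unfolding FES_congruence_def
  by (rule arg_cong[where f = Inter]) (auto simp: ehresmann_semigroup_quot_iff closed_sterm)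

lemma is_congruence_FES: "is_congruence (sterm_algebra X) (FES_congruence X)"
  unfolding FES_congruence_alt
  using is_congruence_total[OF closed_sterm[of X]] ehresmann_identities_carrier[OF closed_sterm[of X]]
  by (intro is_congruence_Inter) blast+

theorem ehresmann_semigroup_FES: "ehresmann_semigroup (FES X)"
  unfolding FES_def ehresmann_semigroup_quot_iff[OF is_congruence_FES closed_sterm]
  by (auto simp: FES_congruence_alt)

lemma ehresmann_monoid_quot_iff:
  assumes r: "is_congruence S r" and c: "closed_carrier S" and u: "\<e>\<^bsub>S\<^esub> \<in> carrier S"
  shows "ehresmann_monoid (quot_monoid S r) \<longleftrightarrow> ehresmann_identities S \<subseteq> r
    \<and> (\<forall>x\<in>carrier S. (\<e>\<^bsub>S\<^esub> \<odot>\<^bsub>S\<^esub> x, x) \<in> r \<and> (x \<odot>\<^bsub>S\<^esub> \<e>\<^bsub>S\<^esub>, x) \<in> r)"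
proof -
  have e: "equiv (carrier S) r" using r by (simp add: is_congruence_def)
  have "ehresmann_semigroup (quot_monoid S r) \<longleftrightarrow> ehresmann_semigroup (quot S r)"
    by (simp add: ehresmann_semigroup_def quot_monoid_def)
  moreover have "ehresmann_monoid_axioms (quot_monoid S r) \<longleftrightarrow>
      (\<forall>x\<in>carrier S. (\<e>\<^bsub>S\<^esub> \<odot>\<^bsub>S\<^esub> x, x) \<in> r \<and> (x \<odot>\<^bsub>S\<^esub> \<e>\<^bsub>S\<^esub>, x) \<in> r)"
  proof -
    have "ehresmann_monoid_axioms (quot_monoid S r) \<longleftrightarrow>
       (\<forall>A\<in>carrier S // r. r `` {\<e>\<^bsub>S\<^esub>} \<odot>\<^bsub>quot S r\<^esub> A = A \<and> A \<odot>\<^bsub>quot S r\<^esub> r `` {\<e>\<^bsub>S\<^esub>} = A)"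
      using u by (auto simp: ehresmann_monoid_axioms_def quot_monoid_def quot_simps(1)[OF r] quotientI)
    also have "\<dots> \<longleftrightarrow> (\<forall>x\<in>carrier S. (\<e>\<^bsub>S\<^esub> \<odot>\<^bsub>S\<^esub> x, x) \<in> r \<and> (x \<odot>\<^bsub>S\<^esub> \<e>\<^bsub>S\<^esub>, x) \<in> r)"
      unfolding ball_quotient using u c
      by (simp add: quot_simps[OF r] eq_equiv_class_iff[OF e] closed_carrier_def cong: ball_cong)
    finally show ?thesis .
  qed
  ultimately show ?thesis
    by (simp add: ehresmann_monoid_def ehresmann_semigroup_quot_iff[OF r c])
qed

lemma unit_mterm: "\<e>\<^bsub>mterm_algebra X\<^esub> \<in> carrier (mterm_algebra X)"
  by (simp add: mterm_algebra_def)

lemma FEM_congruence_alt: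
  "FEM_congruence X = \<Inter>{r. is_congruence (mterm_algebra X) r \<and> ehresmann_identities (mterm_algebra X) \<subseteq> r
    \<and> (\<forall>x\<in>carrier (mterm_algebra X). (\<e>\<^bsub>mterm_algebra X\<^esub> \<odot>\<^bsub>mterm_algebra X\<^esub> x, x) \<in> r
         \<and> (x \<odot>\<^bsub>mterm_algebra X\<^esub> \<e>\<^bsub>mterm_algebra X\<^esub>, x) \<in> r)}"
  unfolding FEM_congruence_def
  by (rule arg_cong[where f = Inter]) (auto simp: ehresmann_monoid_quot_iff closed_mterm unit_mterm)

lemma is_congruence_FEM: "is_congruence (mterm_algebra X) (FEM_congruence X)"
  unfolding FEM_congruence_alt
proof (intro is_congruence_Inter)
  let ?T = "mterm_algebra X"
  have "carrier ?T \<times> carrier ?T \<in> {r. is_congruence ?T r \<and> ehresmann_identities ?T \<subseteq> r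
    \<and> (\<forall>x\<in>carrier ?T. (\<e>\<^bsub>?T\<^esub> \<odot>\<^bsub>?T\<^esub> x, x) \<in> r \<and> (x \<odot>\<^bsub>?T\<^esub> \<e>\<^bsub>?T\<^esub>, x) \<in> r)}"
    using is_congruence_total[OF closed_mterm[of X]] ehresmann_identities_carrier[OF closed_mterm[of X]]
      unit_mterm[of X] closed_mterm[of X] by (simp add: closed_carrier_def)
  then show "{r. is_congruence ?T r \<and> ehresmann_identities ?T \<subseteq> r
    \<and> (\<forall>x\<in>carrier ?T. (\<e>\<^bsub>?T\<^esub> \<odot>\<^bsub>?T\<^esub> x, x) \<in> r \<and> (x \<odot>\<^bsub>?T\<^esub> \<e>\<^bsub>?T\<^esub>, x) \<in> r)} \<noteq> {}" by blast
qed blast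

theorem ehresmann_monoid_FEM: "ehresmann_monoid (FEM X)"
  unfolding FEM_def ehresmann_monoid_quot_iff[OF is_congruence_FEM closed_mterm unit_mterm]
  by (auto simp: FEM_congruence_alt)

lemma is_congruence_kernel:
  assumes h: "is_hom S A h" and c: "closed_carrier S"
  shows "is_congruence S {(a, b). a \<in> carrier S \<and> b \<in> carrier S \<and> h a = h b}"
  using h c unfolding is_congruence_def is_hom_def closed_carrier_def equiv_def refl_on_def sym_def trans_def
  by auto

lemma ehresmann_identities_kernel:
  assumes h: "is_hom S A h" and c: "closed_carrier S" and A: "ehresmann_semigroup A"
  shows "ehresmann_identities S \<subseteq> {(a, b). a \<in> carrier S \<and> b \<in> carrier S \<and> h a = h b}"
proof -
  interpret A: ehresmann_semigroup A by (rule A)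
  have hh: "\<And>x. x \<in> carrier S \<Longrightarrow> h x \<in> carrier A"
     "\<And>x y. \<lbrakk>x \<in> carrier S; y \<in> carrier S\<rbrakk> \<Longrightarrow> h (x \<odot>\<^bsub>S\<^esub> y) = h x \<odot>\<^bsub>A\<^esub> h y"
     "\<And>x. x \<in> carrier S \<Longrightarrow> h (x\<^sup>\<oplus>\<^bsub>S\<^esub>) = (h x)\<^sup>\<oplus>\<^bsub>A\<^esub>" "\<And>x. x \<in> carrier S \<Longrightarrow> h (x\<^sup>\<star>\<^bsub>S\<^esub>) = (h x)\<^sup>\<star>\<^bsub>A\<^esub>"
    using h by (auto simp: is_hom_def)
  have cl: "\<And>x y. \<lbrakk>x \<in> carrier S; y \<in> carrier S\<rbrakk> \<Longrightarrow> x \<odot>\<^bsub>S\<^esub> y \<in> carrier S"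
    "\<And>x. x \<in> carrier S \<Longrightarrow> x\<^sup>\<oplus>\<^bsub>S\<^esub> \<in> carrier S" "\<And>x. x \<in> carrier S \<Longrightarrow> x\<^sup>\<star>\<^bsub>S\<^esub> \<in> carrier S"
    using c by (auto simp: closed_carrier_def)
  show ?thesis
    by (auto simp: ehresmann_identities_def ehresmann_identities_at_def hh cl A.assoc A.pluss_left A.starr_right
        A.pluss_starr A.starr_pluss A.pluss_pluss A.starr_starr
        simp flip: A.pluss_mult A.starr_mult intro!: A.pluss_commute A.starr_commute hh(1))
qed

lemma hom_lift:
  assumes r: "is_congruence S r" and c: "closed_carrier S" and h: "is_hom S A h"
    and le: "r \<subseteq> {(a, b). a \<in> carrier S \<and> b \<in> carrier S \<and> h a = h b}"
  obtains g where "is_hom (quot S r) A g" "\<And>a. a \<in> carrier S \<Longrightarrow> g (r `` {a}) = h a"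
proof
  define g where "g = (\<lambda>C. h (SOME a. a \<in> C))"
  have e: "equiv (carrier S) r" using r by (simp add: is_congruence_def)
  show gc: "g (r `` {a}) = h a" if "a \<in> carrier S" for a
  proof -
    have "(SOME b. b \<in> r `` {a}) \<in> r `` {a}"
      by (rule someI[of _ a]) (rule equiv_class_self[OF e that])
    then show ?thesis using le by (auto simp: g_def simp del: Image_singleton_iff)
  qed
  show "is_hom (quot S r) A g"
    using h c unfolding is_hom_def closed_carrier_def quot_simps(1)[OF r] ball_quotient
    by (simp add: quot_simps[OF r] gc cong: ball_cong)
qed

theorem FES_gen_carrier: "x \<in> X \<Longrightarrow> FES_gen X x \<in> carrier (FES X)"
  unfolding FES_def quot_simps(1)[OF is_congruence_FES] FES_gen_def
  by (rule quotientI) (simp add: sterm_algebra_def)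

theorem FEM_gen_carrier: "x \<in> X \<Longrightarrow> FEM_gen X x \<in> carrier (FEM X)"
  unfolding FEM_def quot_monoid_def biunary_semigroup.simps quot_simps(1)[OF is_congruence_FEM] FEM_gen_def
  by (rule quotientI) (simp add: mterm_algebra_def)

primrec sterm_eval :: "('b, 'm) biunary_semigroup_scheme \<Rightarrow> ('a \<Rightarrow> 'b) \<Rightarrow> 'a sterm \<Rightarrow> 'b" where
  "sterm_eval A f (SGen x) = f x"
| "sterm_eval A f (SMult s t) = sterm_eval A f s \<odot>\<^bsub>A\<^esub> sterm_eval A f t"
| "sterm_eval A f (SPlus s) = (sterm_eval A f s)\<^sup>\<oplus>\<^bsub>A\<^esub>"
| "sterm_eval A f (SStar s) = (sterm_eval A f s)\<^sup>\<star>\<^bsub>A\<^esub>"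

primrec mterm_eval :: "('b, 'm) biunary_monoid_scheme \<Rightarrow> ('a \<Rightarrow> 'b) \<Rightarrow> 'a mterm \<Rightarrow> 'b" where
  "mterm_eval A f (MGen x) = f x"
| "mterm_eval A f MUnit = \<e>\<^bsub>A\<^esub>"
| "mterm_eval A f (MMult s t) = mterm_eval A f s \<odot>\<^bsub>A\<^esub> mterm_eval A f t"
| "mterm_eval A f (MPlus s) = (mterm_eval A f s)\<^sup>\<oplus>\<^bsub>A\<^esub>"
| "mterm_eval A f (MStar s) = (mterm_eval A f s)\<^sup>\<star>\<^bsub>A\<^esub>"

theorem FES_universal:
  assumes A: "ehresmann_semigroup A" and f: "\<And>x. x \<in> X \<Longrightarrow> f x \<in> carrier A"
  shows "\<exists>g. is_hom (FES X) A g \<and> (\<forall>x\<in>X. g (FES_gen X x) = f x)"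
proof -
  let ?T = "sterm_algebra X" and ?h = "sterm_eval A f"
  interpret A: ehresmann_semigroup A by (rule A)
  have "?h t \<in> carrier A" if "set_sterm t \<subseteq> X" for t
    using that by (induction t) (auto intro: f A.mult_closed A.pluss_closed A.starr_closed)
  then have h: "is_hom ?T A ?h" by (simp add: is_hom_def sterm_algebra_def)
  have "FES_congruence X \<subseteq> {(a, b). a \<in> carrier ?T \<and> b \<in> carrier ?T \<and> ?h a = ?h b}"
    unfolding FES_congruence_alt
    using is_congruence_kernel[OF h closed_sterm] ehresmann_identities_kernel[OF h closed_sterm A]
    by (intro Inter_lower) blast
  from hom_lift[OF is_congruence_FES closed_sterm h this] obtain g where
    g: "is_hom (FES X) A g" "\<And>a. a \<in> carrier ?T \<Longrightarrow> g (FES_congruence X `` {a}) = ?h a"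
    unfolding FES_def by blast
  have "g (FES_gen X x) = f x" if "x \<in> X" for x
    using g(2)[of "SGen x"] that by (simp add: FES_gen_def sterm_algebra_def)
  with g(1) show ?thesis by blast
qed

theorem FES_universal_unique:
  assumes g: "is_hom (FES X) A g" and g': "is_hom (FES X) A g'"
    and eq: "\<And>x. x \<in> X \<Longrightarrow> g (FES_gen X x) = g' (FES_gen X x)" and s: "s \<in> carrier (FES X)"
  shows "g s = g' s"
proof -
  note q = quot_simps[OF is_congruence_FES[of X]]
  let ?c = "\<lambda>t. FES_congruence X `` {t}"
  have cF: "?c t \<in> carrier (FES X)" if "set_sterm t \<subseteq> X" for t
    using that by (simp add: FES_def q) (simp add: quotientI sterm_algebra_def)
  have "g (?c t) = g' (?c t)" if "set_sterm t \<subseteq> X" for t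
    using that
  proof (induction t)
    case (SGen x) then show ?case using eq by (simp add: FES_gen_def)
  next
    case (SMult t u)
    then have "?c (SMult t u) = ?c t \<odot>\<^bsub>FES X\<^esub> ?c u" using q(2)[of t u] by (simp add: FES_def sterm_algebra_def)
    with SMult g g' cF show ?case by (simp add: is_hom_def)
  next
    case (SPlus t)
    then have "?c (SPlus t) = (?c t)\<^sup>\<oplus>\<^bsub>FES X\<^esub>" using q(3)[of t] by (simp add: FES_def sterm_algebra_def)
    with SPlus g g' cF show ?case by (simp add: is_hom_def)
  next
    case (SStar t)
    then have "?c (SStar t) = (?c t)\<^sup>\<star>\<^bsub>FES X\<^esub>" using q(4)[of t] by (simp add: FES_def sterm_algebra_def)
    with SStar g g' cF show ?case by (simp add: is_hom_def)
  qed
  moreover from s have "s \<in> carrier (sterm_algebra X) // FES_congruence X" by (simp add: FES_def q)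
  ultimately show ?thesis by (auto simp: quotient_def sterm_algebra_def)
qed

theorem FEM_universal:
  assumes A: "ehresmann_monoid A" and f: "\<And>x. x \<in> X \<Longrightarrow> f x \<in> carrier A"
  shows "\<exists>g. is_hom (FEM X) A g \<and> g \<e>\<^bsub>FEM X\<^esub> = \<e>\<^bsub>A\<^esub> \<and> (\<forall>x\<in>X. g (FEM_gen X x) = f x)"
proof -
  let ?T = "mterm_algebra X" and ?h = "mterm_eval A f"
  interpret A: ehresmann_monoid A by (rule A)
  have hc: "?h t \<in> carrier A" if "set_mterm t \<subseteq> X" for t
    using that by (induction t) (auto intro: f A.mult_closed A.pluss_closed A.starr_closed A.unit_closed)
  then have h: "is_hom ?T A ?h" by (simp add: is_hom_def mterm_algebra_def)
  let ?k = "{(a, b). a \<in> carrier ?T \<and> b \<in> carrier ?T \<and> ?h a = ?h b}"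
  have "\<forall>x\<in>carrier ?T. (\<e>\<^bsub>?T\<^esub> \<odot>\<^bsub>?T\<^esub> x, x) \<in> ?k \<and> (x \<odot>\<^bsub>?T\<^esub> \<e>\<^bsub>?T\<^esub>, x) \<in> ?k"
    by (simp add: mterm_algebra_def hc A.unit_left A.unit_right)
  then have "FEM_congruence X \<subseteq> ?k"
    unfolding FEM_congruence_alt
    using is_congruence_kernel[OF h closed_mterm]
      ehresmann_identities_kernel[OF h closed_mterm A.ehresmann_semigroup_axioms]
    by (intro Inter_lower) blast
  from hom_lift[OF is_congruence_FEM closed_mterm h this] obtain g where
    g: "is_hom (quot ?T (FEM_congruence X)) A g"
      "\<And>a. a \<in> carrier ?T \<Longrightarrow> g (FEM_congruence X `` {a}) = ?h a"
    by blast
  have "g (FEM_gen X x) = f x" if "x \<in> X" for x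
    using g(2)[of "MGen x"] that by (simp add: FEM_gen_def mterm_algebra_def)
  moreover have "g \<e>\<^bsub>FEM X\<^esub> = \<e>\<^bsub>A\<^esub>"
    using g(2)[of MUnit] by (simp add: FEM_def quot_monoid_def mterm_algebra_def)
  moreover have "is_hom (FEM X) A g" using g(1) by (simp add: is_hom_def FEM_def quot_monoid_def)
  ultimately show ?thesis by blast
qed

theorem FEM_universal_unique:
  assumes g: "is_hom (FEM X) A g" "g \<e>\<^bsub>FEM X\<^esub> = \<e>\<^bsub>A\<^esub>"
    and g': "is_hom (FEM X) A g'" "g' \<e>\<^bsub>FEM X\<^esub> = \<e>\<^bsub>A\<^esub>"
    and eq: "\<And>x. x \<in> X \<Longrightarrow> g (FEM_gen X x) = g' (FEM_gen X x)" and s: "s \<in> carrier (FEM X)"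
  shows "g s = g' s"
proof -
  note q = quot_simps[OF is_congruence_FEM[of X]]
  let ?c = "\<lambda>t. FEM_congruence X `` {t}"
  have cF: "?c t \<in> carrier (FEM X)" if "set_mterm t \<subseteq> X" for t
    using that by (simp add: FEM_def quot_monoid_def q) (simp add: quotientI mterm_algebra_def)
  have "g (?c t) = g' (?c t)" if "set_mterm t \<subseteq> X" for t
    using that
  proof (induction t)
    case (MGen x) then show ?case using eq by (simp add: FEM_gen_def)
  next
    case MUnit
    have "?c MUnit = \<e>\<^bsub>FEM X\<^esub>" by (simp add: FEM_def quot_monoid_def mterm_algebra_def)
    with g(2) g'(2) show ?case by simp
  next
    case (MMult t u)
    then have "?c (MMult t u) = ?c t \<odot>\<^bsub>FEM X\<^esub> ?c u"
      using q(2)[of t u] by (simp add: FEM_def quot_monoid_def mterm_algebra_def)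
    with MMult g g' cF show ?case by (simp add: is_hom_def)
  next
    case (MPlus t)
    then have "?c (MPlus t) = (?c t)\<^sup>\<oplus>\<^bsub>FEM X\<^esub>"
      using q(3)[of t] by (simp add: FEM_def quot_monoid_def mterm_algebra_def)
    with MPlus g g' cF show ?case by (simp add: is_hom_def)
  next
    case (MStar t)
    then have "?c (MStar t) = (?c t)\<^sup>\<star>\<^bsub>FEM X\<^esub>"
      using q(4)[of t] by (simp add: FEM_def quot_monoid_def mterm_algebra_def)
    with MStar g g' cF show ?case by (simp add: is_hom_def)
  qed
  moreover from s have "s \<in> carrier (mterm_algebra X) // FEM_congruence X"
    by (simp add: FEM_def quot_monoid_def q)
  ultimately show ?thesis by (auto simp: quotient_def mterm_algebra_def)
qed

end

theory Submission
  imports Defs "HOL-Library.FuncSet"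
begin

text \<open>
  Let \<open>S\<close> be free on \<open>X\<close>. A general element of \<open>S\<close> can be written
  \<open>p\<^sub>0 x\<^sub>1 p\<^sub>1 x\<^sub>2 \<dots> x\<^sub>n p\<^sub>n\<close> with generators \<open>x\<^sub>i\<close> and projections \<open>p\<^sub>i\<close>; the word
  \<open>x\<^sub>1 \<dots> x\<^sub>n\<close> is an invariant of its \<open>\<sigma>\<close>-class. The order ideal \<open>Y\<close> consists of the elements
  whose word has length at most one (\<open>elementary\<close>), that is, of the projections and of the
  elements \<open>p x q\<close>. Since \<open>s = p x q\<close> implies \<open>s = s\<^sup>+ x s\<^sup>*\<close>, such an element is determined by its
  word and its two projections, and so the elements of \<open>Y\<close> are proper.

  Matching factorizations into \<open>Y\<close> exist because the elements that have one form a subsemigroup: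
  \<open>s t\<close> is the product of the matching elements \<open>s t\<^sup>+\<close> and \<open>s\<^sup>* t\<close>, and multiplying the last
  factor of a matching factorization by a projection can be compensated by restricting the factors
  before it one after the other (\<open>matching_factorization_mult\<close>).

  For uniqueness, a projection in a matching factorization with at least two factors can be
  absorbed by a neighbour, which is a step of the relation \<open>\<rightarrow>\<close>. What has to be seen is that the
  remaining factors, one for each letter of the word, depend on \<open>s\<close> only. This is where freeness
  enters, and it does so through the universal property alone. Over any Ehresmann semigroup \<open>S\<close>
  there is an Ehresmann semigroup \<open>trunk_algebra S\<close> whose elements are pairs of an \<open>s \<in> S\<close> and a
  list of labelled functions; a function in the list sends \<open>(f, e)\<close> to the factor that its letter
  contributes inside \<open>f s e\<close>. Products only shift the contexts, \<open>f s (t e)\<close> for the letters of \<open>s\<close>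
  and \<open>(f s) t e\<close> for those of \<open>t\<close>, which is why the axioms are easy to verify. The homomorphism
  from the free object that sends a generator \<open>x\<close> to \<open>x\<close> together with \<open>(f, e) \<mapsto> f\<^sup>* x e\<^sup>+\<close>
  therefore attaches such a list to every \<open>s\<close>, and evaluating it at \<open>(s\<^sup>+, s\<^sup>*)\<close> yields the factors
  other than projections of any matching factorization of \<open>s\<close> into \<open>Y\<close>
  (\<open>trunk_factors_factorization\<close>).
\<close>

section \<open>Projections and products of matching elements\<close>

context ehresmann_semigroup
begin

lemmas closed [simp, intro] = mult_closed pluss_closed starr_closed

lemma projections_carrier: "p \<in> projections S \<Longrightarrow> p \<in> carrier S"
  by (auto simp: projections_def)

lemma pluss_in_projections [simp]: "s \<in> carrier S \<Longrightarrow> s\<^sup>\<oplus> \<in> projections S"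
  by (auto simp: projections_def)

lemma starr_in_projections [simp]: "s \<in> carrier S \<Longrightarrow> s\<^sup>\<star> \<in> projections S"
  unfolding projections_def using starr_pluss[of s, symmetric] starr_closed[of s] by blast

lemma projection_starr [simp]: "p \<in> projections S \<Longrightarrow> p\<^sup>\<star> = p"
  by (auto simp: projections_def pluss_starr)

lemma projection_pluss [simp]: "p \<in> projections S \<Longrightarrow> p\<^sup>\<oplus> = p"
  by (metis projection_starr projections_carrier starr_pluss)

lemma projection_idem [simp]: "p \<in> projections S \<Longrightarrow> p \<odot> p = p"
  by (metis projection_starr projections_carrier starr_right)

lemma projection_commute:
  "\<lbrakk>p \<in> projections S; q \<in> projections S\<rbrakk> \<Longrightarrow> p \<odot> q = q \<odot> p"
  by (metis projection_pluss projections_carrier pluss_commute)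

lemma projections_mult: "\<lbrakk>p \<in> projections S; q \<in> projections S\<rbrakk> \<Longrightarrow> p \<odot> q \<in> projections S"
  by (metis mult_closed pluss_in_projections projection_pluss projections_carrier pluss_pluss)

lemma pluss_projection_mult:
  "\<lbrakk>p \<in> projections S; s \<in> carrier S\<rbrakk> \<Longrightarrow> (p \<odot> s)\<^sup>\<oplus> = p \<odot> s\<^sup>\<oplus>"
  by (metis pluss_mult pluss_pluss projection_pluss projections_carrier)

lemma starr_mult_projection:
  "\<lbrakk>p \<in> projections S; s \<in> carrier S\<rbrakk> \<Longrightarrow> (s \<odot> p)\<^sup>\<star> = s\<^sup>\<star> \<odot> p"
  by (metis starr_mult starr_starr projection_starr projections_carrier)

lemma pluss_matching_mult:
  "\<lbrakk>s \<in> carrier S; t \<in> carrier S; s\<^sup>\<star> = t\<^sup>\<oplus>\<rbrakk> \<Longrightarrow> (s \<odot> t)\<^sup>\<oplus> = s\<^sup>\<oplus>"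
  by (metis pluss_mult starr_right)

lemma starr_matching_mult:
  "\<lbrakk>s \<in> carrier S; t \<in> carrier S; s\<^sup>\<star> = t\<^sup>\<oplus>\<rbrakk> \<Longrightarrow> (s \<odot> t)\<^sup>\<star> = t\<^sup>\<star>"
  by (metis starr_mult pluss_left)

lemma pluss_absorb:
  "\<lbrakk>p \<in> projections S; s \<in> carrier S; p \<odot> s = s\<rbrakk> \<Longrightarrow> s\<^sup>\<oplus> \<odot> p = s\<^sup>\<oplus>"
  by (metis pluss_projection_mult projection_commute pluss_in_projections)

lemma starr_absorb:
  "\<lbrakk>p \<in> projections S; s \<in> carrier S; s \<odot> p = s\<rbrakk> \<Longrightarrow> p \<odot> s\<^sup>\<star> = s\<^sup>\<star>"
  by (metis starr_mult_projection projection_commute starr_in_projections)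

text \<open>An element of the form \<open>p g q\<close> does not determine \<open>p\<close> and \<open>q\<close>, but its own two
  projections can always be taken in their place, because they lie below \<open>p\<close> and \<open>q\<close>.\<close>

lemma sandwich_normal:
  assumes "p \<in> projections S" "q \<in> projections S" "g \<in> carrier S" "s = p \<odot> g \<odot> q"
  shows "s\<^sup>\<oplus> \<odot> p = s\<^sup>\<oplus>" "q \<odot> s\<^sup>\<star> = s\<^sup>\<star>" "s = s\<^sup>\<oplus> \<odot> g \<odot> s\<^sup>\<star>"
proof -
  note c = projections_carrier[OF assms(1)] projections_carrier[OF assms(2)] assms(3)
  have s: "s \<in> carrier S" using c assms by auto
  have "p \<odot> s = s" using c assms projection_idem[OF assms(1)] by (metis assoc mult_closed)
  then show 1: "s\<^sup>\<oplus> \<odot> p = s\<^sup>\<oplus>" using pluss_absorb assms s by blast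
  have "s \<odot> q = s" using c assms projection_idem[OF assms(2)] by (metis assoc mult_closed)
  then show 2: "q \<odot> s\<^sup>\<star> = s\<^sup>\<star>" using starr_absorb assms s by blast
  have "s = s\<^sup>\<oplus> \<odot> (p \<odot> g \<odot> q) \<odot> s\<^sup>\<star>" using s assms(4) by (simp add: pluss_left starr_right)
  also have "\<dots> = (s\<^sup>\<oplus> \<odot> p) \<odot> g \<odot> (q \<odot> s\<^sup>\<star>)" using s c by (simp add: assoc)
  finally show "s = s\<^sup>\<oplus> \<odot> g \<odot> s\<^sup>\<star>" by (simp add: 1 2)
qed

end

section \<open>Matching factorizations\<close>

lemma list_mult_Cons: "xs \<noteq> [] \<Longrightarrow> list_mult S (x # xs) = x \<odot>\<^bsub>S\<^esub> list_mult S xs"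
  by (cases xs) auto

context ehresmann_semigroup
begin

lemma list_mult_closed: "\<lbrakk>xs \<noteq> []; set xs \<subseteq> carrier S\<rbrakk> \<Longrightarrow> list_mult S xs \<in> carrier S"
  by (induction xs rule: induct_list012) auto

lemma list_mult_append:
  "\<lbrakk>xs \<noteq> []; ys \<noteq> []; set xs \<subseteq> carrier S; set ys \<subseteq> carrier S\<rbrakk>
    \<Longrightarrow> list_mult S (xs @ ys) = list_mult S xs \<odot> list_mult S ys"
  by (induction xs rule: list_nonempty_induct)
     (auto simp: list_mult_Cons assoc list_mult_closed)

lemma matching_factorization_closed: "matching_factorization S Y s xs \<Longrightarrow> s \<in> carrier S"
  by (auto simp: matching_factorization_def list_mult_closed)

lemma matching_factorization_ends:
  assumes "matching_factorization S Y s xs"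
  shows "s\<^sup>\<oplus> = (hd xs)\<^sup>\<oplus>" "s\<^sup>\<star> = (last xs)\<^sup>\<star>"
proof -
  have "xs \<noteq> []" "set xs \<subseteq> carrier S" "successively (\<lambda>a b. a\<^sup>\<star> = b\<^sup>\<oplus>) xs"
    "s = list_mult S xs"
    using assms by (auto simp: matching_factorization_def)
  then have "s\<^sup>\<oplus> = (hd xs)\<^sup>\<oplus> \<and> s\<^sup>\<star> = (last xs)\<^sup>\<star>"
  proof (induction xs arbitrary: s rule: induct_list012)
    case (3 x y zs)
    then have "(list_mult S (y # zs))\<^sup>\<oplus> = y\<^sup>\<oplus>" "(list_mult S (y # zs))\<^sup>\<star> = (last (y # zs))\<^sup>\<star>"
      "list_mult S (y # zs) \<in> carrier S"
      using list_mult_closed[of "y # zs"] by auto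
    with 3 show ?case by (simp add: pluss_matching_mult starr_matching_mult)
  qed auto
  then show "s\<^sup>\<oplus> = (hd xs)\<^sup>\<oplus>" "s\<^sup>\<star> = (last xs)\<^sup>\<star>" by auto
qed

lemma matching_factorization_single:
  "matching_factorization S Y s [x] \<longleftrightarrow> s = x \<and> x \<in> Y \<and> x \<in> carrier S"
  by (auto simp: matching_factorization_def)

lemma matching_factorization_append:
  assumes "matching_factorization S Y s xs" "matching_factorization S Y t ys" "s\<^sup>\<star> = t\<^sup>\<oplus>"
  shows "matching_factorization S Y (s \<odot> t) (xs @ ys)"
  using assms matching_factorization_ends[OF assms(1)] matching_factorization_ends[OF assms(2)]
  by (auto simp: matching_factorization_def list_mult_append successively_append_iff)

lemma matching_factorization_appendD:
  assumes "matching_factorization S Y s (xs @ ys)" "xs \<noteq> []" "ys \<noteq> []"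
  shows "matching_factorization S Y (list_mult S xs) xs" "matching_factorization S Y (list_mult S ys) ys"
    "s = list_mult S xs \<odot> list_mult S ys" "(list_mult S xs)\<^sup>\<star> = (list_mult S ys)\<^sup>\<oplus>"
proof -
  show 1: "matching_factorization S Y (list_mult S xs) xs" 
    and 2: "matching_factorization S Y (list_mult S ys) ys"
    and "s = list_mult S xs \<odot> list_mult S ys"
    using assms by (auto simp: matching_factorization_def list_mult_append successively_append_iff)
  show "(list_mult S xs)\<^sup>\<star> = (list_mult S ys)\<^sup>\<oplus>"
    using assms matching_factorization_ends[OF 1] matching_factorization_ends[OF 2]
    by (auto simp: matching_factorization_def successively_append_iff)
qed

lemma matching_factorization_merge:
  assumes m: "matching_factorization S Y s (us @ [a, b] @ ws)" and ab: "a \<odot> b \<in> Y"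
  shows "matching_factorization S Y s (us @ [a \<odot> b] @ ws)"
proof -
  have c: "a \<in> carrier S" "b \<in> carrier S" "a\<^sup>\<star> = b\<^sup>\<oplus>" "set us \<subseteq> carrier S" "set ws \<subseteq> carrier S"
    using m by (auto simp: matching_factorization_def successively_append_iff)
  then have e: "(a \<odot> b)\<^sup>\<oplus> = a\<^sup>\<oplus>" "(a \<odot> b)\<^sup>\<star> = b\<^sup>\<star>"
    by (auto simp: pluss_matching_mult starr_matching_mult)
  have w: "list_mult S (a # b # ws) = list_mult S ((a \<odot> b) # ws)"
    using c by (cases ws) (auto simp: assoc list_mult_closed)
  have "list_mult S (us @ [a, b] @ ws) = list_mult S (us @ [a \<odot> b] @ ws)"
    using c w by (cases "us = []") (auto simp: list_mult_append)
  with m ab c e show ?thesis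
    by (cases ws) (auto simp: matching_factorization_def successively_append_iff)
qed

text \<open>Multiplying the last factor of \<open>x\<^sub>1 \<cdots> x\<^sub>n\<close> by a projection can make \<open>x\<^sub>n\<^sup>+\<close> smaller than
  \<open>x\<^sub>n\<^sub>-\<^sub>1\<^sup>*\<close>. Multiplying \<open>x\<^sub>n\<^sub>-\<^sub>1\<close> by the new \<open>x\<^sub>n\<^sup>+\<close> restores the match without changing the
  product, and so on towards the first factor. The new factors lie below the old ones, hence
  again in the order ideal.\<close>

lemma matching_factorization_mult_projection:
  assumes Y: "order_ideal S Y" and m: "matching_factorization S Y s xs" and e: "e \<in> projections S"
  shows "\<exists>ys. matching_factorization S Y (s \<odot> e) ys"
  using m
proof (induction xs arbitrary: s)
  case Nil
  then show ?case by (simp add: matching_factorization_def)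
next
  case (Cons x xs)
  have x: "x \<in> Y" "x \<in> carrier S" using Cons.prems by (auto simp: matching_factorization_def)
  have ideal: "x \<odot> p \<in> Y" if "p \<in> projections S" for p
  proof -
    have "natural_le S (x \<odot> p) x"
      unfolding natural_le_def using that x
      by (intro bexI[of _ "x\<^sup>\<oplus>"] bexI[of _ p]) (auto simp: pluss_left)
    then show ?thesis
      using Y x that by (auto simp: order_ideal_def projections_carrier)
  qed
  show ?case
  proof (cases "xs = []")
    case True
    with Cons.prems have "s = x" by (simp add: matching_factorization_single)
    with ideal[OF e] x e have "matching_factorization S Y (s \<odot> e) [x \<odot> e]"
      by (simp add: matching_factorization_single projections_carrier)
    then show ?thesis by blast
  next
    case False
    define m where "m = list_mult S xs"
    have D: "matching_factorization S Y m xs" "s = x \<odot> m" "x\<^sup>\<star> = m\<^sup>\<oplus>"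
      using matching_factorization_appendD[of Y s "[x]" xs] Cons.prems False by (auto simp: m_def)
    from Cons.IH[OF D(1)] obtain ys where ys: "matching_factorization S Y (m \<odot> e) ys" by blast
    have c: "m \<in> carrier S" "e \<in> carrier S"
      using D(1) e by (auto simp: matching_factorization_closed projections_carrier)
    have "(x \<odot> (m \<odot> e)\<^sup>\<oplus>)\<^sup>\<star> = (m\<^sup>\<oplus> \<odot> (m \<odot> e))\<^sup>\<oplus>"
      using c x D(3) by (simp add: starr_mult_projection pluss_projection_mult)
    also have "\<dots> = (m \<odot> e)\<^sup>\<oplus>" using c by (simp add: pluss_left flip: assoc)
    finally have "matching_factorization S Y ((x \<odot> (m \<odot> e)\<^sup>\<oplus>) \<odot> (m \<odot> e)) ([x \<odot> (m \<odot> e)\<^sup>\<oplus>] @ ys)"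
      using ys ideal x c
      by (intro matching_factorization_append) (auto simp: matching_factorization_single)
    moreover have "(x \<odot> (m \<odot> e)\<^sup>\<oplus>) \<odot> (m \<odot> e) = s \<odot> e"
      using x c D(2) by (simp add: assoc pluss_left)
    ultimately show ?thesis by auto
  qed
qed

lemma matching_factorization_projection_mult:
  assumes Y: "order_ideal S Y" and m: "matching_factorization S Y s xs" and e: "e \<in> projections S"
  shows "\<exists>ys. matching_factorization S Y (e \<odot> s) ys"
  using m e
proof (induction xs arbitrary: s e)
  case Nil
  then show ?case by (simp add: matching_factorization_def)
next
  case (Cons x xs)
  have x: "x \<in> Y" "x \<in> carrier S" using Cons.prems by (auto simp: matching_factorization_def)
  have "natural_le S (e \<odot> x) x"
    unfolding natural_le_def using Cons.prems x
    by (intro bexI[of _ e] bexI[of _ "x\<^sup>\<star>"]) (auto simp: starr_right assoc projections_carrier)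
  then have ideal: "e \<odot> x \<in> Y" using Y x Cons.prems by (auto simp: order_ideal_def projections_carrier)
  show ?case
  proof (cases "xs = []")
    case True
    with Cons.prems have "s = x" by (simp add: matching_factorization_single)
    with ideal x Cons.prems have "matching_factorization S Y (e \<odot> s) [e \<odot> x]"
      by (simp add: matching_factorization_single projections_carrier)
    then show ?thesis by blast
  next
    case False
    define m where "m = list_mult S xs"
    have D: "matching_factorization S Y m xs" "s = x \<odot> m" "x\<^sup>\<star> = m\<^sup>\<oplus>"
      using matching_factorization_appendD[of Y s "[x]" xs] Cons.prems False by (auto simp: m_def)
    have c: "m \<in> carrier S" "e \<in> carrier S"
      using D(1) Cons.prems by (auto simp: matching_factorization_closed projections_carrier)
    obtain ys where ys: "matching_factorization S Y ((e \<odot> x)\<^sup>\<star> \<odot> m) ys"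
      using Cons.IH[OF D(1), of "(e \<odot> x)\<^sup>\<star>"] x c by auto
    have "((e \<odot> x)\<^sup>\<star> \<odot> m)\<^sup>\<oplus> = (e \<odot> x)\<^sup>\<star> \<odot> x\<^sup>\<star>"
      using c x D(3) by (simp add: pluss_projection_mult)
    also have "\<dots> = (e \<odot> x \<odot> x\<^sup>\<star>)\<^sup>\<star>" using c x by (simp add: starr_mult_projection)
    also have "\<dots> = (e \<odot> x)\<^sup>\<star>" using c x by (simp add: assoc starr_right)
    finally have "matching_factorization S Y ((e \<odot> x) \<odot> ((e \<odot> x)\<^sup>\<star> \<odot> m)) ([e \<odot> x] @ ys)"
      using ys ideal x c
      by (intro matching_factorization_append) (auto simp: matching_factorization_single)
    moreover have "(e \<odot> x) \<odot> ((e \<odot> x)\<^sup>\<star> \<odot> m) = e \<odot> s"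
      using x c D(2) by (simp only: assoc[of "e \<odot> x", symmetric] starr_right closed) (simp add: assoc)
    ultimately show ?thesis by auto
  qed
qed

text \<open>The elements \<open>s t\<^sup>+\<close> and \<open>s\<^sup>* t\<close> match, as \<open>(s t\<^sup>+)\<^sup>* = s\<^sup>* t\<^sup>+ = (s\<^sup>* t)\<^sup>+\<close>, and their product
  is \<open>s t\<close>.\<close>

lemma matching_factorization_mult:
  assumes Y: "order_ideal S Y"
    and s: "matching_factorization S Y s xs" and t: "matching_factorization S Y t ys"
  shows "\<exists>zs. matching_factorization S Y (s \<odot> t) zs"
proof -
  have c: "s \<in> carrier S" "t \<in> carrier S" using s t by (auto simp: matching_factorization_closed)
  obtain xs' where xs': "matching_factorization S Y (s \<odot> t\<^sup>\<oplus>) xs'"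
    using matching_factorization_mult_projection[OF Y s, of "t\<^sup>\<oplus>"] c by auto
  obtain ys' where ys': "matching_factorization S Y (s\<^sup>\<star> \<odot> t) ys'"
    using matching_factorization_projection_mult[OF Y t, of "s\<^sup>\<star>"] c by auto
  have "matching_factorization S Y ((s \<odot> t\<^sup>\<oplus>) \<odot> (s\<^sup>\<star> \<odot> t)) (xs' @ ys')"
    using c by (intro matching_factorization_append xs' ys')
      (simp add: starr_mult_projection pluss_projection_mult)
  moreover have "(s \<odot> t\<^sup>\<oplus>) \<odot> (s\<^sup>\<star> \<odot> t) = s \<odot> ((t\<^sup>\<oplus> \<odot> s\<^sup>\<star>) \<odot> t)" using c by (simp add: assoc)
  moreover have "\<dots> = s \<odot> ((s\<^sup>\<star> \<odot> t\<^sup>\<oplus>) \<odot> t)" using c by (simp add: projection_commute)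
  moreover have "\<dots> = (s \<odot> s\<^sup>\<star>) \<odot> (t\<^sup>\<oplus> \<odot> t)" using c by (simp add: assoc)
  ultimately show ?thesis using c by (auto simp: pluss_left starr_right)
qed

end

section \<open>Recording the factors along the trunk\<close>

text \<open>If \<open>\<phi>\<close> records a letter of \<open>s\<close>, the following two functions record the same letter inside
  \<open>s t\<close> and inside \<open>t s\<close>. Restricting them to the carrier makes equality of functions the same
  as equality in all contexts from \<open>S\<close>.\<close>

definition right_translate :: "('a, 'm) biunary_semigroup_scheme \<Rightarrow> 'a \<Rightarrow> ('a \<times> 'a \<Rightarrow> 'a) \<Rightarrow> 'a \<times> 'a \<Rightarrow> 'a" where
  "right_translate S t \<phi> = (\<lambda>(f, e) \<in> carrier S \<times> carrier S. \<phi> (f, t \<odot>\<^bsub>S\<^esub> e))"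

definition left_translate :: "('a, 'm) biunary_semigroup_scheme \<Rightarrow> 'a \<Rightarrow> ('a \<times> 'a \<Rightarrow> 'a) \<Rightarrow> 'a \<times> 'a \<Rightarrow> 'a" where
  "left_translate S s \<phi> = (\<lambda>(f, e) \<in> carrier S \<times> carrier S. \<phi> (f \<odot>\<^bsub>S\<^esub> s, e))"

text \<open>The factor that a letter of \<open>s\<close> contributes inside \<open>f s e\<close> sees the left context \<open>f\<close> only
  through \<open>f\<^sup>*\<close>, and that only up to multiplication by \<open>(s e)\<^sup>+\<close>, because \<open>(s e)\<^sup>+ (s e) = s e\<close>;
  dually for the right context. These two conditions are strong enough for the laws \<open>s\<^sup>+ s = s = s s\<^sup>*\<close>
  to hold in the algebra below, and they are preserved when contexts are shifted.\<close>

definition admissible :: "('a, 'm) biunary_semigroup_scheme \<Rightarrow> 'a \<Rightarrow> ('a \<times> 'a \<Rightarrow> 'a) \<Rightarrow> bool" where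
  "admissible S s \<phi> \<longleftrightarrow> \<phi> \<in> extensional (carrier S \<times> carrier S)
    \<and> (\<forall>f\<in>carrier S. \<forall>f'\<in>carrier S. \<forall>e\<in>carrier S.
         f\<^sup>\<star>\<^bsub>S\<^esub> \<odot>\<^bsub>S\<^esub> (s \<odot>\<^bsub>S\<^esub> e)\<^sup>\<oplus>\<^bsub>S\<^esub> = f'\<^sup>\<star>\<^bsub>S\<^esub> \<odot>\<^bsub>S\<^esub> (s \<odot>\<^bsub>S\<^esub> e)\<^sup>\<oplus>\<^bsub>S\<^esub> \<longrightarrow> \<phi> (f, e) = \<phi> (f', e))
    \<and> (\<forall>f\<in>carrier S. \<forall>e\<in>carrier S. \<forall>e'\<in>carrier S.
         (f \<odot>\<^bsub>S\<^esub> s)\<^sup>\<star>\<^bsub>S\<^esub> \<odot>\<^bsub>S\<^esub> e\<^sup>\<oplus>\<^bsub>S\<^esub> = (f \<odot>\<^bsub>S\<^esub> s)\<^sup>\<star>\<^bsub>S\<^esub> \<odot>\<^bsub>S\<^esub> e'\<^sup>\<oplus>\<^bsub>S\<^esub> \<longrightarrow> \<phi> (f, e) = \<phi> (f, e'))"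

text \<open>In the description of free Ehresmann monoids by birooted trees, the word of an element labels
  the path between the two roots, called the trunk; a projection has a trunk without edges. The
  parameter \<open>extra\<close> fills the record extension, so that the same construction serves semigroups
  and monoids.\<close>

definition trunk_algebra :: "('a, 'm) biunary_semigroup_scheme \<Rightarrow> 'n
    \<Rightarrow> ('a \<times> ('x \<times> ('a \<times> 'a \<Rightarrow> 'a)) list, 'n) biunary_semigroup_scheme" where
  "trunk_algebra S extra =
    \<lparr>carrier = {(s, \<Phi>). s \<in> carrier S \<and> (\<forall>\<phi> \<in> snd ` set \<Phi>. admissible S s \<phi>)},
     mult = (\<lambda>(s, \<Phi>) (t, \<Psi>). (s \<odot>\<^bsub>S\<^esub> t,
        map (apsnd (right_translate S t)) \<Phi> @ map (apsnd (left_translate S s)) \<Psi>)),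
     pluss = (\<lambda>(s, \<Phi>). (s\<^sup>\<oplus>\<^bsub>S\<^esub>, [])),
     starr = (\<lambda>(s, \<Phi>). (s\<^sup>\<star>\<^bsub>S\<^esub>, [])),
     \<dots> = extra\<rparr>"

text \<open>The matching factorization \<open>f g e = (f (g e)\<^sup>+) (f\<^sup>* g e\<^sup>+) ((f g)\<^sup>* e)\<close> shows what \<open>g\<close>
  contributes inside \<open>f g e\<close>.\<close>

definition generator_trunk :: "('a, 'm) biunary_semigroup_scheme \<Rightarrow> 'x \<Rightarrow> 'a \<Rightarrow> ('x \<times> ('a \<times> 'a \<Rightarrow> 'a)) list" where
  "generator_trunk S x g = [(x, \<lambda>(f, e) \<in> carrier S \<times> carrier S. f\<^sup>\<star>\<^bsub>S\<^esub> \<odot>\<^bsub>S\<^esub> g \<odot>\<^bsub>S\<^esub> e\<^sup>\<oplus>\<^bsub>S\<^esub>)]"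

context ehresmann_semigroup
begin

lemma admissible_extensional: "admissible S s \<phi> \<Longrightarrow> \<phi> \<in> extensional (carrier S \<times> carrier S)"
  by (simp add: admissible_def)

lemma admissible_left_eq:
  "\<lbrakk>admissible S s \<phi>; f\<^sup>\<star> \<odot> (s \<odot> e)\<^sup>\<oplus> = f'\<^sup>\<star> \<odot> (s \<odot> e)\<^sup>\<oplus>;
    f \<in> carrier S; f' \<in> carrier S; e \<in> carrier S\<rbrakk> \<Longrightarrow> \<phi> (f, e) = \<phi> (f', e)"
  unfolding admissible_def by blast

lemma admissible_right_eq:
  "\<lbrakk>admissible S s \<phi>; (f \<odot> s)\<^sup>\<star> \<odot> e\<^sup>\<oplus> = (f \<odot> s)\<^sup>\<star> \<odot> e'\<^sup>\<oplus>;
    f \<in> carrier S; e \<in> carrier S; e' \<in> carrier S\<rbrakk> \<Longrightarrow> \<phi> (f, e) = \<phi> (f, e')"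
  unfolding admissible_def by blast

text \<open>The left context of \<open>s\<close> is not affected by the shift. For right contexts, the reason is that
  \<open>(f s)\<^sup>* (t e)\<^sup>+\<close> depends on \<open>e\<close> only through \<open>(f s t)\<^sup>* e\<^sup>+\<close>.\<close>

lemma admissible_right_translate:
  assumes a: "admissible S s \<phi>" and s: "s \<in> carrier S" and t: "t \<in> carrier S"
  shows "admissible S (s \<odot> t) (right_translate S t \<phi>)"
proof -
  have "(f \<odot> s)\<^sup>\<star> \<odot> (t \<odot> e)\<^sup>\<oplus> = (((f \<odot> s)\<^sup>\<star> \<odot> t) \<odot> ((f \<odot> (s \<odot> t))\<^sup>\<star> \<odot> e\<^sup>\<oplus>))\<^sup>\<oplus>"
    if "f \<in> carrier S" "e \<in> carrier S" for f e
  proof -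
    let ?u = "(f \<odot> s)\<^sup>\<star> \<odot> t"
    have u: "?u \<in> carrier S" using that s t by auto
    have "?u\<^sup>\<star> = (f \<odot> (s \<odot> t))\<^sup>\<star>" using that s t by (simp add: starr_mult[of "f \<odot> s"] flip: assoc)
    then have "?u \<odot> ((f \<odot> (s \<odot> t))\<^sup>\<star> \<odot> e\<^sup>\<oplus>) = (?u \<odot> ?u\<^sup>\<star>) \<odot> e\<^sup>\<oplus>" using u that s t by (simp only: assoc closed)
    also have "\<dots> = ?u \<odot> e\<^sup>\<oplus>" using u by (simp add: starr_right)
    finally have "(?u \<odot> ((f \<odot> (s \<odot> t))\<^sup>\<star> \<odot> e\<^sup>\<oplus>))\<^sup>\<oplus> = (?u \<odot> e)\<^sup>\<oplus>" using u that by (simp add: pluss_mult[of ?u e])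
    also have "\<dots> = (f \<odot> s)\<^sup>\<star> \<odot> (t \<odot> e)\<^sup>\<oplus>" using that s t by (simp add: assoc pluss_projection_mult)
    finally show ?thesis ..
  qed
  note shift = this
  show ?thesis
    unfolding admissible_def
  proof (intro conjI ballI impI)
    show "right_translate S t \<phi> \<in> extensional (carrier S \<times> carrier S)"
      by (simp add: right_translate_def)
  next
    fix f f' e assume c: "f \<in> carrier S" "f' \<in> carrier S" "e \<in> carrier S"
      and "f\<^sup>\<star> \<odot> (s \<odot> t \<odot> e)\<^sup>\<oplus> = f'\<^sup>\<star> \<odot> (s \<odot> t \<odot> e)\<^sup>\<oplus>"
    then show "right_translate S t \<phi> (f, e) = right_translate S t \<phi> (f', e)"
      using admissible_left_eq[OF a, of f "t \<odot> e" f'] s t by (simp add: right_translate_def assoc)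
  next
    fix f e e' assume c: "f \<in> carrier S" "e \<in> carrier S" "e' \<in> carrier S"
      and "(f \<odot> (s \<odot> t))\<^sup>\<star> \<odot> e\<^sup>\<oplus> = (f \<odot> (s \<odot> t))\<^sup>\<star> \<odot> e'\<^sup>\<oplus>"
    then have "(f \<odot> s)\<^sup>\<star> \<odot> (t \<odot> e)\<^sup>\<oplus> = (f \<odot> s)\<^sup>\<star> \<odot> (t \<odot> e')\<^sup>\<oplus>"
      by (simp only: shift[OF c(1,2)] shift[OF c(1,3)])
    then show "right_translate S t \<phi> (f, e) = right_translate S t \<phi> (f, e')"
      using admissible_right_eq[OF a, of f "t \<odot> e" "t \<odot> e'"] c t by (simp add: right_translate_def)
  qed
qed

lemma admissible_left_translate:
  assumes a: "admissible S t \<psi>" and s: "s \<in> carrier S" and t: "t \<in> carrier S"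
  shows "admissible S (s \<odot> t) (left_translate S s \<psi>)"
proof -
  have "(f \<odot> s)\<^sup>\<star> \<odot> (t \<odot> e)\<^sup>\<oplus> = ((f\<^sup>\<star> \<odot> (s \<odot> t \<odot> e)\<^sup>\<oplus>) \<odot> (s \<odot> (t \<odot> e)\<^sup>\<oplus>))\<^sup>\<star>"
    if "f \<in> carrier S" "e \<in> carrier S" for f e
  proof -
    let ?u = "s \<odot> (t \<odot> e)\<^sup>\<oplus>"
    have u: "?u \<in> carrier S" using that s t by auto
    have "?u\<^sup>\<oplus> = (s \<odot> t \<odot> e)\<^sup>\<oplus>" using that s t by (simp add: assoc flip: pluss_mult[of s "t \<odot> e"])
    then have "(f\<^sup>\<star> \<odot> (s \<odot> t \<odot> e)\<^sup>\<oplus>) \<odot> ?u = f\<^sup>\<star> \<odot> (?u\<^sup>\<oplus> \<odot> ?u)" using u that s t by (simp only: assoc closed)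
    also have "\<dots> = f\<^sup>\<star> \<odot> ?u" using u by (simp add: pluss_left)
    finally have "((f\<^sup>\<star> \<odot> (s \<odot> t \<odot> e)\<^sup>\<oplus>) \<odot> ?u)\<^sup>\<star> = (f \<odot> ?u)\<^sup>\<star>" using u that by (simp add: starr_mult[of f ?u])
    also have "\<dots> = (f \<odot> s)\<^sup>\<star> \<odot> (t \<odot> e)\<^sup>\<oplus>" using that s t by (simp add: starr_mult_projection flip: assoc)
    finally show ?thesis ..
  qed
  note shift = this
  show ?thesis
    unfolding admissible_def
  proof (intro conjI ballI impI)
    show "left_translate S s \<psi> \<in> extensional (carrier S \<times> carrier S)"
      by (simp add: left_translate_def)
  next
    fix f f' e assume c: "f \<in> carrier S" "f' \<in> carrier S" "e \<in> carrier S"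
      and "f\<^sup>\<star> \<odot> (s \<odot> t \<odot> e)\<^sup>\<oplus> = f'\<^sup>\<star> \<odot> (s \<odot> t \<odot> e)\<^sup>\<oplus>"
    then have "(f \<odot> s)\<^sup>\<star> \<odot> (t \<odot> e)\<^sup>\<oplus> = (f' \<odot> s)\<^sup>\<star> \<odot> (t \<odot> e)\<^sup>\<oplus>"
      by (simp only: shift[OF c(1,3)] shift[OF c(2,3)])
    then show "left_translate S s \<psi> (f, e) = left_translate S s \<psi> (f', e)"
      using admissible_left_eq[OF a, of "f \<odot> s" e "f' \<odot> s"] c s by (simp add: left_translate_def)
  next
    fix f e e' assume c: "f \<in> carrier S" "e \<in> carrier S" "e' \<in> carrier S"
      and "(f \<odot> (s \<odot> t))\<^sup>\<star> \<odot> e\<^sup>\<oplus> = (f \<odot> (s \<odot> t))\<^sup>\<star> \<odot> e'\<^sup>\<oplus>"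
    then show "left_translate S s \<psi> (f, e) = left_translate S s \<psi> (f, e')"
      using admissible_right_eq[OF a, of "f \<odot> s" e e'] s t by (simp add: left_translate_def assoc)
  qed
qed

lemma admissible_generator:
  assumes g: "g \<in> carrier S"
  shows "(g, generator_trunk S x g) \<in> carrier (trunk_algebra S extra)"
proof -
  have l: "f\<^sup>\<star> \<odot> g \<odot> e\<^sup>\<oplus> = (f\<^sup>\<star> \<odot> (g \<odot> e)\<^sup>\<oplus>) \<odot> (g \<odot> e\<^sup>\<oplus>)"
    and r: "f\<^sup>\<star> \<odot> g \<odot> e\<^sup>\<oplus> = (f\<^sup>\<star> \<odot> g) \<odot> ((f \<odot> g)\<^sup>\<star> \<odot> e\<^sup>\<oplus>)" if "f \<in> carrier S" "e \<in> carrier S" for f e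
  proof -
    have "f\<^sup>\<star> \<odot> g \<odot> e\<^sup>\<oplus> = f\<^sup>\<star> \<odot> ((g \<odot> e\<^sup>\<oplus>)\<^sup>\<oplus> \<odot> (g \<odot> e\<^sup>\<oplus>))" using that g by (simp add: pluss_left assoc)
    also have "\<dots> = (f\<^sup>\<star> \<odot> (g \<odot> e)\<^sup>\<oplus>) \<odot> (g \<odot> e\<^sup>\<oplus>)" using that g by (simp only: assoc closed pluss_mult[of g e])
    finally show "f\<^sup>\<star> \<odot> g \<odot> e\<^sup>\<oplus> = (f\<^sup>\<star> \<odot> (g \<odot> e)\<^sup>\<oplus>) \<odot> (g \<odot> e\<^sup>\<oplus>)" .
    have "f\<^sup>\<star> \<odot> g \<odot> e\<^sup>\<oplus> = ((f\<^sup>\<star> \<odot> g) \<odot> (f\<^sup>\<star> \<odot> g)\<^sup>\<star>) \<odot> e\<^sup>\<oplus>" using that g by (simp add: starr_right)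
    also have "\<dots> = (f\<^sup>\<star> \<odot> g) \<odot> ((f \<odot> g)\<^sup>\<star> \<odot> e\<^sup>\<oplus>)" using that g by (simp only: assoc closed starr_mult[of f g])
    finally show "f\<^sup>\<star> \<odot> g \<odot> e\<^sup>\<oplus> = (f\<^sup>\<star> \<odot> g) \<odot> ((f \<odot> g)\<^sup>\<star> \<odot> e\<^sup>\<oplus>)" .
  qed
  have "admissible S g (\<lambda>(f, e) \<in> carrier S \<times> carrier S. f\<^sup>\<star> \<odot> g \<odot> e\<^sup>\<oplus>)"
    unfolding admissible_def
  proof (intro conjI ballI impI)
    fix f f' e assume "f \<in> carrier S" "f' \<in> carrier S" "e \<in> carrier S"
      "f\<^sup>\<star> \<odot> (g \<odot> e)\<^sup>\<oplus> = f'\<^sup>\<star> \<odot> (g \<odot> e)\<^sup>\<oplus>"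
    then show "(\<lambda>(f, e) \<in> carrier S \<times> carrier S. f\<^sup>\<star> \<odot> g \<odot> e\<^sup>\<oplus>) (f, e)
       = (\<lambda>(f, e) \<in> carrier S \<times> carrier S. f\<^sup>\<star> \<odot> g \<odot> e\<^sup>\<oplus>) (f', e)"
      using l[of f e] l[of f' e] by (simp del: closed) 
  next
    fix f e e' assume "f \<in> carrier S" "e \<in> carrier S" "e' \<in> carrier S"
      "(f \<odot> g)\<^sup>\<star> \<odot> e\<^sup>\<oplus> = (f \<odot> g)\<^sup>\<star> \<odot> e'\<^sup>\<oplus>"
    then show "(\<lambda>(f, e) \<in> carrier S \<times> carrier S. f\<^sup>\<star> \<odot> g \<odot> e\<^sup>\<oplus>) (f, e)
       = (\<lambda>(f, e) \<in> carrier S \<times> carrier S. f\<^sup>\<star> \<odot> g \<odot> e\<^sup>\<oplus>) (f, e')"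
      using r[of f e] r[of f e'] by simp
  qed auto
  then show ?thesis using g by (auto simp: trunk_algebra_def generator_trunk_def)
qed

lemma left_translate_pluss:
  assumes a: "admissible S s \<phi>" and s: "s \<in> carrier S"
  shows "left_translate S (s\<^sup>\<oplus>) \<phi> = \<phi>"
proof (rule extensionalityI)
  show "left_translate S (s\<^sup>\<oplus>) \<phi> \<in> extensional (carrier S \<times> carrier S)"
    "\<phi> \<in> extensional (carrier S \<times> carrier S)"
    by (simp_all add: left_translate_def admissible_extensional[OF a])
  fix z assume "z \<in> carrier S \<times> carrier S"
  then obtain f e where z: "z = (f, e)" "f \<in> carrier S" "e \<in> carrier S" by auto
  have "s\<^sup>\<oplus> \<odot> (s \<odot> e)\<^sup>\<oplus> = (s\<^sup>\<oplus> \<odot> (s \<odot> e))\<^sup>\<oplus>" using z s by (simp add: pluss_projection_mult)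
  also have "\<dots> = (s \<odot> e)\<^sup>\<oplus>" using z s by (simp add: pluss_left flip: assoc)
  finally have "(f \<odot> s\<^sup>\<oplus>)\<^sup>\<star> \<odot> (s \<odot> e)\<^sup>\<oplus> = f\<^sup>\<star> \<odot> (s \<odot> e)\<^sup>\<oplus>"
    using z s by (simp add: starr_mult_projection assoc)
  then have "\<phi> (f \<odot> s\<^sup>\<oplus>, e) = \<phi> (f, e)"
    using admissible_left_eq[OF a] z s by blast
  with z show "left_translate S (s\<^sup>\<oplus>) \<phi> z = \<phi> z" by (simp add: left_translate_def)
qed

lemma right_translate_starr:
  assumes a: "admissible S s \<phi>" and s: "s \<in> carrier S"
  shows "right_translate S (s\<^sup>\<star>) \<phi> = \<phi>"
proof (rule extensionalityI)
  show "right_translate S (s\<^sup>\<star>) \<phi> \<in> extensional (carrier S \<times> carrier S)"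
    "\<phi> \<in> extensional (carrier S \<times> carrier S)"
    by (simp_all add: right_translate_def admissible_extensional[OF a])
  fix z assume "z \<in> carrier S \<times> carrier S"
  then obtain f e where z: "z = (f, e)" "f \<in> carrier S" "e \<in> carrier S" by auto
  have "(f \<odot> s)\<^sup>\<star> \<odot> s\<^sup>\<star> = ((f \<odot> s) \<odot> s\<^sup>\<star>)\<^sup>\<star>" using z s by (simp add: starr_mult_projection)
  also have "\<dots> = (f \<odot> s)\<^sup>\<star>" using z s by (simp add: starr_right assoc)
  finally have "(f \<odot> s)\<^sup>\<star> \<odot> (s\<^sup>\<star> \<odot> e)\<^sup>\<oplus> = (f \<odot> s)\<^sup>\<star> \<odot> e\<^sup>\<oplus>"
    using z s by (simp add: pluss_projection_mult flip: assoc)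
  then have "\<phi> (f, s\<^sup>\<star> \<odot> e) = \<phi> (f, e)"
    using admissible_right_eq[OF a] z s by blast
  with z show "right_translate S (s\<^sup>\<star>) \<phi> z = \<phi> z" by (simp add: right_translate_def)
qed

text \<open>Projections carry the empty list, so the axioms that equate projections hold because they
  hold in \<open>S\<close>. Associativity holds because shifts of contexts compose, and shifts on different
  sides commute.\<close>

lemma ehresmann_semigroup_trunk_algebra: "ehresmann_semigroup (trunk_algebra S extra)"
proof -
  have rr: "right_translate S u (right_translate S t \<phi>) = right_translate S (t \<odot> u) \<phi>"
    and ll: "left_translate S s (left_translate S t \<phi>) = left_translate S (s \<odot> t) \<phi>"
    and lr: "right_translate S u (left_translate S s \<phi>) = left_translate S s (right_translate S u \<phi>)"
    if "s \<in> carrier S" "t \<in> carrier S" "u \<in> carrier S" for s t u \<phi>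
    using that by (simp_all add: right_translate_def left_translate_def restrict_def assoc fun_eq_iff)
  show ?thesis
  proof
    fix x y z :: "'a \<times> ('x \<times> ('a \<times> 'a \<Rightarrow> 'a)) list"
    let ?A = "trunk_algebra S extra"
    obtain s \<Phi> t \<Psi> u \<Omega> where eq: "x = (s, \<Phi>)" "y = (t, \<Psi>)" "z = (u, \<Omega>)"
      by (metis surj_pair)
    note A = trunk_algebra_def
    assume "x \<in> carrier ?A"
    then have x: "s \<in> carrier S" "\<And>a \<phi>. (a, \<phi>) \<in> set \<Phi> \<Longrightarrow> admissible S s \<phi>"
      by (force simp: A eq)+
    show "x\<^sup>\<oplus>\<^bsub>?A\<^esub> \<in> carrier ?A" "x\<^sup>\<star>\<^bsub>?A\<^esub> \<in> carrier ?A"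
      "(x\<^sup>\<oplus>\<^bsub>?A\<^esub>)\<^sup>\<star>\<^bsub>?A\<^esub> = x\<^sup>\<oplus>\<^bsub>?A\<^esub>" "(x\<^sup>\<star>\<^bsub>?A\<^esub>)\<^sup>\<oplus>\<^bsub>?A\<^esub> = x\<^sup>\<star>\<^bsub>?A\<^esub>"
      using x by (simp_all add: A eq pluss_starr starr_pluss)
    show "x\<^sup>\<oplus>\<^bsub>?A\<^esub> \<odot>\<^bsub>?A\<^esub> x = x"
      using x by (auto simp: A eq pluss_left left_translate_pluss intro!: map_idI)
    show "x \<odot>\<^bsub>?A\<^esub> x\<^sup>\<star>\<^bsub>?A\<^esub> = x"
      using x by (auto simp: A eq starr_right right_translate_starr intro!: map_idI)
    assume "y \<in> carrier ?A"
    then have y: "t \<in> carrier S" "\<And>a \<phi>. (a, \<phi>) \<in> set \<Psi> \<Longrightarrow> admissible S t \<phi>"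
      by (force simp: A eq)+
    show "x \<odot>\<^bsub>?A\<^esub> y \<in> carrier ?A"
      using x y by (auto simp: A eq admissible_left_translate admissible_right_translate)
    show "x\<^sup>\<oplus>\<^bsub>?A\<^esub> \<odot>\<^bsub>?A\<^esub> y\<^sup>\<oplus>\<^bsub>?A\<^esub> = y\<^sup>\<oplus>\<^bsub>?A\<^esub> \<odot>\<^bsub>?A\<^esub> x\<^sup>\<oplus>\<^bsub>?A\<^esub>"
      using pluss_commute[OF x(1) y(1)] by (simp add: A eq)
    show "x\<^sup>\<star>\<^bsub>?A\<^esub> \<odot>\<^bsub>?A\<^esub> y\<^sup>\<star>\<^bsub>?A\<^esub> = y\<^sup>\<star>\<^bsub>?A\<^esub> \<odot>\<^bsub>?A\<^esub> x\<^sup>\<star>\<^bsub>?A\<^esub>"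
      using starr_commute[OF x(1) y(1)] by (simp add: A eq)
    show "(x\<^sup>\<oplus>\<^bsub>?A\<^esub> \<odot>\<^bsub>?A\<^esub> y\<^sup>\<oplus>\<^bsub>?A\<^esub>)\<^sup>\<oplus>\<^bsub>?A\<^esub> = x\<^sup>\<oplus>\<^bsub>?A\<^esub> \<odot>\<^bsub>?A\<^esub> y\<^sup>\<oplus>\<^bsub>?A\<^esub>"
      using pluss_pluss[OF x(1) y(1)] by (simp add: A eq)
    show "(x\<^sup>\<star>\<^bsub>?A\<^esub> \<odot>\<^bsub>?A\<^esub> y\<^sup>\<star>\<^bsub>?A\<^esub>)\<^sup>\<star>\<^bsub>?A\<^esub> = x\<^sup>\<star>\<^bsub>?A\<^esub> \<odot>\<^bsub>?A\<^esub> y\<^sup>\<star>\<^bsub>?A\<^esub>"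
      using starr_starr[OF x(1) y(1)] by (simp add: A eq)
    show "(x \<odot>\<^bsub>?A\<^esub> y)\<^sup>\<oplus>\<^bsub>?A\<^esub> = (x \<odot>\<^bsub>?A\<^esub> y\<^sup>\<oplus>\<^bsub>?A\<^esub>)\<^sup>\<oplus>\<^bsub>?A\<^esub>"
      using pluss_mult[OF x(1) y(1)] by (simp add: A eq)
    show "(x \<odot>\<^bsub>?A\<^esub> y)\<^sup>\<star>\<^bsub>?A\<^esub> = (x\<^sup>\<star>\<^bsub>?A\<^esub> \<odot>\<^bsub>?A\<^esub> y)\<^sup>\<star>\<^bsub>?A\<^esub>"
      using starr_mult[OF x(1) y(1)] by (simp add: A eq)
    assume "z \<in> carrier ?A"
    then have z: "u \<in> carrier S" by (simp add: A eq)
    show "(x \<odot>\<^bsub>?A\<^esub> y) \<odot>\<^bsub>?A\<^esub> z = x \<odot>\<^bsub>?A\<^esub> (y \<odot>\<^bsub>?A\<^esub> z)"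
      using x(1) y(1) z by (auto simp: A eq assoc rr ll lr[of s u u])
  qed
qed

end

section \<open>Ehresmann semigroups with trunks\<close>

inductive_set semigroup_span :: "('a, 'm) biunary_semigroup_scheme \<Rightarrow> 'a set \<Rightarrow> 'a set"
  for S (structure) and B where
  base: "b \<in> B \<Longrightarrow> b \<in> semigroup_span S B"
| mult: "\<lbrakk>a \<in> semigroup_span S B; b \<in> semigroup_span S B\<rbrakk> \<Longrightarrow> a \<odot> b \<in> semigroup_span S B"

text \<open>What is used of a free object: its generators and projections span it as a semigroup, and
  attaching trunks to its elements is a homomorphism that gives each generator one letter.\<close>

locale trunked_semigroup = ehresmann_semigroup S
  for S :: "('a, 'm) biunary_semigroup_scheme" (structure) +
  fixes X :: "'x set" and gen :: "'x \<Rightarrow> 'a"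
    and trunk :: "'a \<Rightarrow> ('x \<times> ('a \<times> 'a \<Rightarrow> 'a)) list"
  assumes gen_closed: "x \<in> X \<Longrightarrow> gen x \<in> carrier S"
    and spanned: "carrier S \<subseteq> semigroup_span S (projections S \<union> gen ` X)"
    and trunk_hom: "is_hom S (trunk_algebra S ()) (\<lambda>s. (s, trunk s))"
    and trunk_gen: "x \<in> X \<Longrightarrow> trunk (gen x) = generator_trunk S x (gen x)"
begin

lemma trunk_admissible:
  assumes "s \<in> carrier S" "(x, \<phi>) \<in> set (trunk s)"
  shows "admissible S s \<phi>"
proof -
  have "(s, trunk s) \<in> carrier (trunk_algebra S ())"
    using trunk_hom assms(1) unfolding is_hom_def by blast
  with assms(2) show ?thesis by (force simp: trunk_algebra_def)
qed

lemma trunk_mult: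
  assumes "s \<in> carrier S" "t \<in> carrier S"
  shows "trunk (s \<odot> t)
    = map (apsnd (right_translate S t)) (trunk s) @ map (apsnd (left_translate S s)) (trunk t)"
proof -
  have "(s \<odot> t, trunk (s \<odot> t)) = (s, trunk s) \<odot>\<^bsub>trunk_algebra S ()\<^esub> (t, trunk t)"
    using trunk_hom assms unfolding is_hom_def by blast
  then show ?thesis by (simp add: trunk_algebra_def)
qed

lemma trunk_projection:
  assumes "p \<in> projections S"
  shows "trunk p = []"
proof -
  have "(p\<^sup>\<oplus>, trunk (p\<^sup>\<oplus>)) = (p, trunk p)\<^sup>\<oplus>\<^bsub>trunk_algebra S ()\<^esub>"
    using trunk_hom projections_carrier[OF assms] unfolding is_hom_def by blast
  then show ?thesis using assms by (simp add: trunk_algebra_def)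
qed

definition word :: "'a \<Rightarrow> 'x list" where
  "word s = map fst (trunk s)"

lemma word_mult: "\<lbrakk>s \<in> carrier S; t \<in> carrier S\<rbrakk> \<Longrightarrow> word (s \<odot> t) = word s @ word t"
  by (simp add: word_def trunk_mult)

lemma word_projection: "p \<in> projections S \<Longrightarrow> word p = []"
  by (simp add: word_def trunk_projection)

lemma word_gen: "x \<in> X \<Longrightarrow> word (gen x) = [x]"
  by (simp add: word_def trunk_gen generator_trunk_def)

text \<open>Equality of words is a congruence that identifies all projections.\<close>

lemma sigma_word:
  assumes "(s, t) \<in> sigma S"
  shows "word s = word t"
proof -
  let ?r = "{(a, b). a \<in> carrier S \<and> b \<in> carrier S \<and> word a = word b}"
  have "is_congruence S ?r"
    unfolding is_congruence_def
    by (auto simp: equiv_def refl_on_def sym_def trans_def word_mult word_projection)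
  moreover have "projections S \<times> projections S \<subseteq> ?r"
    by (auto simp: projections_carrier word_projection)
  ultimately have "sigma S \<subseteq> ?r" unfolding sigma_def by blast
  with assms show ?thesis by blast
qed

text \<open>By induction over products: if \<open>a b\<close> has a word of length at most one, then \<open>a\<close> or \<open>b\<close> is
  a projection, and it merges with the outer projections of the other factor.\<close>

lemma short_word_cases:
  assumes "s \<in> semigroup_span S (projections S \<union> gen ` X)"
  shows "s \<in> carrier S \<and> (word s = [] \<longrightarrow> s \<in> projections S)
    \<and> (\<forall>x. word s = [x] \<longrightarrow> x \<in> X \<and> s = s\<^sup>\<oplus> \<odot> gen x \<odot> s\<^sup>\<star>)"
  using assms
proof induction
  case (base s)
  then show ?case
    by (auto simp: projections_carrier gen_closed word_projection word_gen pluss_left starr_right)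
next
  case (mult a b)
  then have c: "a \<in> carrier S" "b \<in> carrier S" by auto
  have "x \<in> X \<and> a \<odot> b = (a \<odot> b)\<^sup>\<oplus> \<odot> gen x \<odot> (a \<odot> b)\<^sup>\<star>" if "word (a \<odot> b) = [x]" for x
  proof -
    have w: "word a @ word b = [x]" using that c by (simp add: word_mult)
    consider "word a = []" "word b = [x]" | "word a = [x]" "word b = []"
      using w by (auto simp: append_eq_Cons_conv)
    then have "\<exists>p\<in>projections S. \<exists>q\<in>projections S. x \<in> X \<and> a \<odot> b = p \<odot> gen x \<odot> q"
    proof cases
      case 1
      then have a: "a \<in> projections S" and x: "x \<in> X" and b: "b = b\<^sup>\<oplus> \<odot> gen x \<odot> b\<^sup>\<star>"
        using mult.IH by auto
      have "a \<odot> b = a \<odot> (b\<^sup>\<oplus> \<odot> gen x \<odot> b\<^sup>\<star>)" using b by simp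
      also have "\<dots> = (a \<odot> b\<^sup>\<oplus>) \<odot> gen x \<odot> b\<^sup>\<star>"
        using c gen_closed[OF x] by (simp only: assoc closed)
      finally show ?thesis
        using a c x projections_mult[OF a, of "b\<^sup>\<oplus>"]
        by (intro bexI[of _ "a \<odot> b\<^sup>\<oplus>"] bexI[of _ "b\<^sup>\<star>"]) simp_all
    next
      case 2
      then have b: "b \<in> projections S" and x: "x \<in> X" and a: "a = a\<^sup>\<oplus> \<odot> gen x \<odot> a\<^sup>\<star>"
        using mult.IH by auto
      have "a \<odot> b = (a\<^sup>\<oplus> \<odot> gen x \<odot> a\<^sup>\<star>) \<odot> b" using a by simp
      also have "\<dots> = a\<^sup>\<oplus> \<odot> gen x \<odot> (a\<^sup>\<star> \<odot> b)"
        using c gen_closed[OF x] by (simp only: assoc closed)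
      finally show ?thesis
        using b c x projections_mult[OF _ b, of "a\<^sup>\<star>"]
        by (intro bexI[of _ "a\<^sup>\<oplus>"] bexI[of _ "a\<^sup>\<star> \<odot> b"]) simp_all
    qed
    then show ?thesis using sandwich_normal(3) gen_closed by blast
  qed
  moreover have "a \<odot> b \<in> projections S" if "word (a \<odot> b) = []"
    using that mult.IH c by (auto simp: word_mult projections_mult)
  ultimately show ?case using c by auto
qed

lemma empty_word: "\<lbrakk>s \<in> carrier S; word s = []\<rbrakk> \<Longrightarrow> s \<in> projections S"
  using short_word_cases spanned by blast

lemma singleton_word:
  "\<lbrakk>s \<in> carrier S; word s = [x]\<rbrakk> \<Longrightarrow> x \<in> X \<and> s = s\<^sup>\<oplus> \<odot> gen x \<odot> s\<^sup>\<star>"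
  using short_word_cases spanned by blast

definition elementary :: "'a set" where
  "elementary = {s \<in> carrier S. length (word s) \<le> 1}"

lemma elementary_cases:
  assumes "s \<in> elementary"
  obtains "s \<in> projections S" | x where "x \<in> X" "word s = [x]" "s = s\<^sup>\<oplus> \<odot> gen x \<odot> s\<^sup>\<star>"
proof -
  from assms consider "word s = []" | x where "word s = [x]"
    by (cases "word s") (auto simp: elementary_def)
  then show ?thesis
    using that assms empty_word singleton_word by cases (auto simp: elementary_def)
qed

lemma projections_elementary: "projections S \<subseteq> elementary"
  by (auto simp: elementary_def projections_carrier word_projection)

lemma order_ideal_elementary: "order_ideal S elementary"
  by (auto simp: order_ideal_def natural_le_def elementary_def word_mult word_projection projections_carrier)

text \<open>If \<open>t\<close> has the word and the projections of \<open>s\<close>, then either both are projections and equal to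
  \<open>s\<^sup>+\<close>, or both are equal to \<open>s\<^sup>+ x s\<^sup>*\<close>.\<close>

lemma elementary_proper:
  assumes s: "s \<in> elementary"
  shows "proper_element S s"
  unfolding proper_element_def
proof (intro conjI ballI impI)
  show "s \<in> carrier S" using s by (simp add: elementary_def)
  fix t assume t: "t \<in> carrier S" "t\<^sup>\<oplus> = s\<^sup>\<oplus>" "t\<^sup>\<star> = s\<^sup>\<star>" and "(t, s) \<in> sigma S"
  then have w: "word t = word s" by (simp add: sigma_word)
  from s show "t = s"
  proof (cases rule: elementary_cases)
    case 1
    then have "t \<in> projections S" using empty_word t(1) w by (simp add: word_projection)
    with 1 t(2) show ?thesis by simp
  next
    case (2 x)
    then show ?thesis using singleton_word[OF t(1), of x] t w by simp
  qed
qed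

lemma factorization_exists:
  assumes "s \<in> carrier S"
  shows "\<exists>xs. matching_factorization S elementary s xs"
proof -
  have "s \<in> semigroup_span S (projections S \<union> gen ` X)" using assms spanned by blast
  then show ?thesis
  proof induction
    case (base s)
    then have "s \<in> elementary" "s \<in> carrier S"
      by (auto simp: elementary_def projections_carrier word_projection word_gen gen_closed)
    then show ?case using matching_factorization_single by blast
  next
    case (mult a b)
    then show ?case using matching_factorization_mult[OF order_ideal_elementary] by blast
  qed
qed

text \<open>In the context of its own two projections, \<open>s\<close> is unchanged, so each letter yields its factor
  in \<open>s\<close> itself. A semigroup need not have an identity, whose place \<open>s\<^sup>+\<close> and \<open>s\<^sup>*\<close> take here.\<close>

definition trunk_factors :: "'a \<Rightarrow> 'a list" where
  "trunk_factors s = map (\<lambda>(x, \<phi>). \<phi> (s\<^sup>\<oplus>, s\<^sup>\<star>)) (trunk s)"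

lemma trunk_factors_projection: "p \<in> projections S \<Longrightarrow> trunk_factors p = []"
  by (simp add: trunk_factors_def trunk_projection)

lemma trunk_factors_elementary:
  assumes s: "s \<in> elementary" and np: "s \<notin> projections S"
  shows "trunk_factors s = [s]"
  using s
proof (cases rule: elementary_cases)
  case 1
  with np show ?thesis by simp
next
  case (2 x)
  have c: "s \<in> carrier S" "gen x \<in> carrier S" using s 2 gen_closed by (auto simp: elementary_def)
  let ?p = "s\<^sup>\<oplus>" and ?q = "s\<^sup>\<star>"
  have "trunk s = trunk ((?p \<odot> gen x) \<odot> ?q)" using 2 by simp
  also have "\<dots> = [(x, right_translate S ?q (left_translate S ?p
      (\<lambda>(f, e) \<in> carrier S \<times> carrier S. f\<^sup>\<star> \<odot> gen x \<odot> e\<^sup>\<oplus>)))]"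
    using c 2(1) by (simp add: trunk_mult trunk_projection trunk_gen generator_trunk_def)
  finally have "trunk_factors s = [(?p \<odot> ?p)\<^sup>\<star> \<odot> gen x \<odot> (?q \<odot> ?q)\<^sup>\<oplus>]"
    using c by (simp add: trunk_factors_def right_translate_def left_translate_def)
  also have "\<dots> = [s]" using c 2(3) by simp
  finally show ?thesis .
qed

text \<open>Inside \<open>s t\<close>, a letter of \<open>s\<close> has the right context \<open>t\<close>, of which it sees only \<open>t\<^sup>+\<close>. When \<open>s\<close>
  and \<open>t\<close> match, this is \<open>s\<^sup>*\<close>, the context in which the factors of \<open>s\<close> alone are computed.\<close>

lemma trunk_factors_mult:
  assumes c: "s \<in> carrier S" "t \<in> carrier S" and m: "s\<^sup>\<star> = t\<^sup>\<oplus>"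
  shows "trunk_factors (s \<odot> t) = trunk_factors s @ trunk_factors t"
proof -
  have l: "right_translate S t \<phi> (s\<^sup>\<oplus>, t\<^sup>\<star>) = \<phi> (s\<^sup>\<oplus>, s\<^sup>\<star>)" if "(x, \<phi>) \<in> set (trunk s)" for x \<phi>
  proof -
    have "\<phi> (s\<^sup>\<oplus>, t) = \<phi> (s\<^sup>\<oplus>, s\<^sup>\<star>)"
      using c m by (intro admissible_right_eq[OF trunk_admissible[OF c(1) that]]) auto
    then show ?thesis using c by (simp add: right_translate_def starr_right)
  qed
  have r: "left_translate S s \<phi> (s\<^sup>\<oplus>, t\<^sup>\<star>) = \<phi> (t\<^sup>\<oplus>, t\<^sup>\<star>)" if "(x, \<phi>) \<in> set (trunk t)" for x \<phi>
  proof -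
    have "\<phi> (s, t\<^sup>\<star>) = \<phi> (t\<^sup>\<oplus>, t\<^sup>\<star>)"
      using c m by (intro admissible_left_eq[OF trunk_admissible[OF c(2) that]]) auto
    then show ?thesis using c by (simp add: left_translate_def pluss_left)
  qed
  show ?thesis
    using c m
    by (auto simp: trunk_factors_def trunk_mult pluss_matching_mult starr_matching_mult l r)
qed

lemma trunk_factors_factorization:
  assumes "matching_factorization S elementary s xs"
  shows "trunk_factors s = filter (\<lambda>y. y \<notin> projections S) xs"
  using assms
proof (induction xs arbitrary: s)
  case Nil
  then show ?case by (simp add: matching_factorization_def)
next
  case (Cons y ys)
  have y: "y \<in> elementary" "y \<in> carrier S" using Cons.prems by (auto simp: matching_factorization_def)
  then have y1: "trunk_factors y = (if y \<in> projections S then [] else [y])"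
    by (simp add: trunk_factors_projection trunk_factors_elementary)
  show ?case
  proof (cases "ys = []")
    case True
    then show ?thesis using Cons.prems y1 by (simp add: matching_factorization_single)
  next
    case False
    note D = matching_factorization_appendD[of elementary s "[y]" ys, simplified, OF Cons.prems False]
    have "trunk_factors s = trunk_factors y @ trunk_factors (list_mult S ys)"
      using D y matching_factorization_closed[OF D(2)] by (simp add: trunk_factors_mult)
    with Cons.IH[OF D(2)] y1 show ?thesis by simp
  qed
qed

text \<open>The letters of a projection yield the empty list, which is not a factorization.\<close>

definition canonical_factorization :: "'a \<Rightarrow> 'a list" where
  "canonical_factorization s = (if s \<in> projections S then [s] else trunk_factors s)"

lemma matching_factorization_mono:
  "\<lbrakk>matching_factorization S Y s xs; Y \<subseteq> Z\<rbrakk> \<Longrightarrow> matching_factorization S Z s xs"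
  by (auto simp: matching_factorization_def)

text \<open>As long as there are at least two factors, a projection among them is absorbed by a
  neighbour: if \<open>a\<^sup>* = b\<^sup>+\<close>, then \<open>a b = b\<close> for a projection \<open>a\<close> and \<open>a b = a\<close> for a projection \<open>b\<close>.
  Once this is no longer possible, either a single projection is left, which is \<open>s\<close> itself, or
  the factors are those that the trunk of \<open>s\<close> determines.\<close>

lemma reduces_to_canonical:
  assumes "matching_factorization S elementary s xs"
  shows "equivclp (reduces S s) xs (canonical_factorization s)"
  using assms
proof (induction "length xs" arbitrary: xs rule: less_induct)
  case less
  note m = less.prems
  have ne: "xs \<noteq> []" using m by (simp add: matching_factorization_def)
  consider "set xs \<inter> projections S = {}" | p where "xs = [p]" "p \<in> projections S"
    | us a b ws where "xs = us @ [a, b] @ ws" "a \<in> projections S \<or> b \<in> projections S"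
  proof (cases "set xs \<inter> projections S = {}")
    case False
    then obtain us p ws where xs: "xs = us @ p # ws" and p: "p \<in> projections S"
      by (meson disjoint_iff split_list)
    show ?thesis
    proof (cases ws)
      case Nil
      show ?thesis
      proof (cases us rule: rev_cases)
        case Nil
        with \<open>ws = []\<close> xs p show ?thesis using that(2) by simp
      next
        case (snoc us' a)
        with \<open>ws = []\<close> xs p show ?thesis using that(3)[of us' a p "[]"] by simp
      qed
    next
      case (Cons b ws')
      with xs p show ?thesis using that(3)[of us p b ws'] by simp
    qed
  qed (use that in blast)
  then show ?case
  proof cases
    case 1
    then have "filter (\<lambda>y. y \<notin> projections S) xs = xs" by (auto simp: filter_id_conv)
    then have "trunk_factors s = xs" using trunk_factors_factorization[OF m] by simp
    moreover from this ne have "s \<notin> projections S" using trunk_factors_projection by auto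
    ultimately show ?thesis by (simp add: canonical_factorization_def)
  next
    case 2
    then show ?thesis using m by (simp add: canonical_factorization_def matching_factorization_single)
  next
    case (3 us a b ws)
    have ab: "a \<in> elementary" "b \<in> elementary" "a \<in> carrier S" "b \<in> carrier S" "a\<^sup>\<star> = b\<^sup>\<oplus>"
      using m 3(1) by (auto simp: matching_factorization_def successively_append_iff)
    from 3(2) have e: "a \<odot> b \<in> elementary"
    proof
      assume "a \<in> projections S"
      with ab show ?thesis by (simp add: pluss_left)
    next
      assume "b \<in> projections S"
      then have "b = a\<^sup>\<star>" using ab(5) by simp
      then have "a \<odot> b = a" using starr_right[OF ab(3)] by simp
      with ab(1) show ?thesis by simp
    qed
    have "proper_factorization S s (us @ [a, b] @ ws)"
      using matching_factorization_mono[OF m] 3(1) elementary_proper by blast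
    moreover have "proper_element S (list_mult S [a, b])" using elementary_proper[OF e] by simp
    ultimately have "reduces S s xs (us @ [a \<odot> b] @ ws)"
      using reduces.intros[of S s us "[a, b]" ws] 3(1) by simp
    then have "equivclp (reduces S s) xs (us @ [a \<odot> b] @ ws)" by (rule r_into_equivclp)
    moreover have "equivclp (reduces S s) (us @ [a \<odot> b] @ ws) (canonical_factorization s)"
      using m 3(1) e by (intro less.hyps matching_factorization_merge) simp_all
    ultimately show ?thesis by (rule equivclp_trans)
  qed
qed

theorem proper: "proper_semigroup S"
  unfolding proper_semigroup_def
proof (intro conjI exI[of _ elementary] ballI allI impI)
  show "ehresmann_semigroup S" by (rule ehresmann_semigroup_axioms)
  fix s xs ys assume "matching_factorization S elementary s xs" "matching_factorization S elementary s ys"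
  then show "equivclp (reduces S s) xs ys"
    using reduces_to_canonical equivclp_sym equivclp_trans by metis
qed (simp_all add: order_ideal_elementary projections_elementary elementary_proper factorization_exists)

end

section \<open>Free Ehresmann semigroups and monoids\<close>

text \<open>Terms become elements of the free object by forming classes, so induction on terms turns
  into an induction principle for its elements.\<close>

lemma FES_induct [consumes 1, case_names gen mult pluss starr]:
  assumes s: "s \<in> carrier (FES X)"
    and gen: "\<And>x. x \<in> X \<Longrightarrow> P (FES_gen X x)"
    and mult: "\<And>s t. \<lbrakk>s \<in> carrier (FES X); t \<in> carrier (FES X); P s; P t\<rbrakk> \<Longrightarrow> P (s \<odot>\<^bsub>FES X\<^esub> t)"
    and pluss: "\<And>s. \<lbrakk>s \<in> carrier (FES X); P s\<rbrakk> \<Longrightarrow> P (s\<^sup>\<oplus>\<^bsub>FES X\<^esub>)"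
    and starr: "\<And>s. \<lbrakk>s \<in> carrier (FES X); P s\<rbrakk> \<Longrightarrow> P (s\<^sup>\<star>\<^bsub>FES X\<^esub>)"
  shows "P s"
proof -
  note q = quot_simps[OF is_congruence_FES[of X]]
  let ?c = "\<lambda>t. FES_congruence X `` {t}"
  have cF: "?c t \<in> carrier (FES X)" if "set_sterm t \<subseteq> X" for t
    using that by (simp add: FES_def q) (simp add: quotientI sterm_algebra_def)
  have "P (?c t)" if "set_sterm t \<subseteq> X" for t
    using that
  proof (induction t)
    case (SGen x)
    then show ?case using gen by (simp add: FES_gen_def)
  next
    case (SMult t u)
    then have "?c (SMult t u) = ?c t \<odot>\<^bsub>FES X\<^esub> ?c u"
      using q(2)[of t u] by (simp add: FES_def sterm_algebra_def)
    with SMult mult cF show ?case by simp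
  next
    case (SPlus t)
    then have "?c (SPlus t) = (?c t)\<^sup>\<oplus>\<^bsub>FES X\<^esub>" using q(3)[of t] by (simp add: FES_def sterm_algebra_def)
    with SPlus pluss cF show ?case by simp
  next
    case (SStar t)
    then have "?c (SStar t) = (?c t)\<^sup>\<star>\<^bsub>FES X\<^esub>" using q(4)[of t] by (simp add: FES_def sterm_algebra_def)
    with SStar starr cF show ?case by simp
  qed
  moreover from s have "s \<in> carrier (sterm_algebra X) // FES_congruence X" by (simp add: FES_def q)
  ultimately show ?thesis by (auto simp: quotient_def sterm_algebra_def)
qed

lemma FEM_induct [consumes 1, case_names gen unit mult pluss starr]:
  assumes s: "s \<in> carrier (FEM X)"
    and gen: "\<And>x. x \<in> X \<Longrightarrow> P (FEM_gen X x)"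
    and unit: "P \<e>\<^bsub>FEM X\<^esub>"
    and mult: "\<And>s t. \<lbrakk>s \<in> carrier (FEM X); t \<in> carrier (FEM X); P s; P t\<rbrakk> \<Longrightarrow> P (s \<odot>\<^bsub>FEM X\<^esub> t)"
    and pluss: "\<And>s. \<lbrakk>s \<in> carrier (FEM X); P s\<rbrakk> \<Longrightarrow> P (s\<^sup>\<oplus>\<^bsub>FEM X\<^esub>)"
    and starr: "\<And>s. \<lbrakk>s \<in> carrier (FEM X); P s\<rbrakk> \<Longrightarrow> P (s\<^sup>\<star>\<^bsub>FEM X\<^esub>)"
  shows "P s"
proof -
  note q = quot_simps[OF is_congruence_FEM[of X]]
  let ?c = "\<lambda>t. FEM_congruence X `` {t}"
  have cF: "?c t \<in> carrier (FEM X)" if "set_mterm t \<subseteq> X" for t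
    using that by (simp add: FEM_def quot_monoid_def q) (simp add: quotientI mterm_algebra_def)
  have "P (?c t)" if "set_mterm t \<subseteq> X" for t
    using that
  proof (induction t)
    case (MGen x)
    then show ?case using gen by (simp add: FEM_gen_def)
  next
    case MUnit
    have "?c MUnit = \<e>\<^bsub>FEM X\<^esub>" by (simp add: FEM_def quot_monoid_def mterm_algebra_def)
    with unit show ?case by simp
  next
    case (MMult t u)
    then have "?c (MMult t u) = ?c t \<odot>\<^bsub>FEM X\<^esub> ?c u"
      using q(2)[of t u] by (simp add: FEM_def quot_monoid_def mterm_algebra_def)
    with MMult mult cF show ?case by simp
  next
    case (MPlus t)
    then have "?c (MPlus t) = (?c t)\<^sup>\<oplus>\<^bsub>FEM X\<^esub>"
      using q(3)[of t] by (simp add: FEM_def quot_monoid_def mterm_algebra_def)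
    with MPlus pluss cF show ?case by simp
  next
    case (MStar t)
    then have "?c (MStar t) = (?c t)\<^sup>\<star>\<^bsub>FEM X\<^esub>"
      using q(4)[of t] by (simp add: FEM_def quot_monoid_def mterm_algebra_def)
    with MStar starr cF show ?case by simp
  qed
  moreover from s have "s \<in> carrier (mterm_algebra X) // FEM_congruence X"
    by (simp add: FEM_def quot_monoid_def q)
  ultimately show ?thesis by (auto simp: quotient_def mterm_algebra_def)
qed

lemma (in ehresmann_semigroup) is_hom_cong:
  assumes "is_hom S T h" "\<And>s. s \<in> carrier S \<Longrightarrow> h s = k s"
  shows "is_hom S T k"
  using assms by (simp add: is_hom_def)

lemma proper_FES: "proper_semigroup (FES X)"
proof -
  let ?F = "FES X"
  interpret F: ehresmann_semigroup ?F by (rule ehresmann_semigroup_FES)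
  let ?A = "trunk_algebra ?F ()" and ?f = "\<lambda>x. (FES_gen X x, generator_trunk ?F x (FES_gen X x))"
  have "\<exists>h. is_hom ?F ?A h \<and> (\<forall>x\<in>X. h (FES_gen X x) = ?f x)"
    by (intro FES_universal F.ehresmann_semigroup_trunk_algebra F.admissible_generator FES_gen_carrier)
  then obtain h where h: "is_hom ?F ?A h" and h_gen: "\<forall>x\<in>X. h (FES_gen X x) = ?f x"
    by (elim exE conjE)
  \<comment> \<open>The first component of \<open>h\<close> is an endomorphism that fixes the generators.\<close>
  have fst_h: "fst (h s) = s" if "s \<in> carrier ?F" for s
    using that
    by (induction rule: FES_induct)
      (use h in \<open>auto simp: h_gen is_hom_def trunk_algebra_def split: prod.splits\<close>)
  then have hs: "h s = (s, snd (h s))" if "s \<in> carrier ?F" for s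
    using that by (metis prod.collapse)
  interpret F: trunked_semigroup ?F X "FES_gen X" "\<lambda>s. snd (h s)"
  proof
    show "carrier ?F \<subseteq> semigroup_span ?F (projections ?F \<union> FES_gen X ` X)"
    proof
      fix s assume "s \<in> carrier ?F"
      then show "s \<in> semigroup_span ?F (projections ?F \<union> FES_gen X ` X)"
        by (induction rule: FES_induct) (auto intro: semigroup_span.intros)
    qed
    show "is_hom ?F (trunk_algebra ?F ()) (\<lambda>s. (s, snd (h s)))"
      by (rule F.is_hom_cong[OF h hs])
  qed (simp_all add: FES_gen_carrier h_gen)
  show ?thesis by (rule F.proper)
qed

abbreviation trunk_monoid :: "('a, 'm) biunary_monoid_scheme
    \<Rightarrow> ('a \<times> ('x \<times> ('a \<times> 'a \<Rightarrow> 'a)) list) biunary_monoid" where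
  "trunk_monoid S \<equiv> trunk_algebra S (biunary_monoid.fields (\<e>\<^bsub>S\<^esub>, []))"

lemma ehresmann_monoid_trunk_monoid:
  assumes "ehresmann_monoid S"
  shows "ehresmann_monoid (trunk_monoid S)"
proof -
  interpret ehresmann_monoid S by (rule assms)
  have id: "left_translate S \<e>\<^bsub>S\<^esub> \<phi> = \<phi>" "right_translate S \<e>\<^bsub>S\<^esub> \<phi> = \<phi>" if "admissible S s \<phi>" for s \<phi>
    using admissible_extensional[OF that]
    by (auto simp: left_translate_def right_translate_def unit_left unit_right unit_closed
        restrict_def extensional_def fun_eq_iff)
  interpret T: ehresmann_semigroup "trunk_monoid S"
    by (rule ehresmann_semigroup_trunk_algebra)
  let ?A = "trunk_monoid S"
  show ?thesis
  proof
    show "\<e>\<^bsub>?A\<^esub> \<in> carrier ?A"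
      by (simp add: trunk_algebra_def biunary_monoid.defs unit_closed)
    fix z assume "z \<in> carrier ?A"
    then obtain s \<Phi> where z: "z = (s, \<Phi>)" "s \<in> carrier S" "\<And>a \<phi>. (a, \<phi>) \<in> set \<Phi> \<Longrightarrow> admissible S s \<phi>"
      by (force simp: trunk_algebra_def)
    show "\<e>\<^bsub>?A\<^esub> \<odot>\<^bsub>?A\<^esub> z = z" "z \<odot>\<^bsub>?A\<^esub> \<e>\<^bsub>?A\<^esub> = z"
      using z by (auto simp: id[OF z(3)] trunk_algebra_def biunary_monoid.defs unit_left unit_right intro!: map_idI)
  qed
qed

lemma proper_FEM: "proper_semigroup (FEM X)"
proof -
  let ?F = "FEM X"
  interpret F: ehresmann_monoid ?F by (rule ehresmann_monoid_FEM)
  let ?A = "trunk_monoid ?F"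
  let ?f = "\<lambda>x. (FEM_gen X x, generator_trunk ?F x (FEM_gen X x))"
  have "\<exists>h. is_hom ?F ?A h \<and> h \<e>\<^bsub>?F\<^esub> = \<e>\<^bsub>?A\<^esub> \<and> (\<forall>x\<in>X. h (FEM_gen X x) = ?f x)"
    by (rule FEM_universal[where f = ?f, OF ehresmann_monoid_trunk_monoid[OF ehresmann_monoid_FEM]
          F.admissible_generator[OF FEM_gen_carrier]])
  then obtain h where h: "is_hom ?F ?A h" and h_unit: "h \<e>\<^bsub>?F\<^esub> = \<e>\<^bsub>?A\<^esub>"
    and h_gen: "\<forall>x\<in>X. h (FEM_gen X x) = ?f x"
    by (elim exE conjE)
  have fst_h: "fst (h s) = s" if "s \<in> carrier ?F" for s
    using that
    by (induction rule: FEM_induct)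
      (use h h_unit in \<open>auto simp: h_gen is_hom_def trunk_algebra_def biunary_monoid.defs split: prod.splits\<close>)
  then have hs: "h s = (s, snd (h s))" if "s \<in> carrier ?F" for s
    using that by (metis prod.collapse)
  \<comment> \<open>The identity is a projection, so the span needs no further generator.\<close>
  have "\<e>\<^bsub>?F\<^esub> = (\<e>\<^bsub>?F\<^esub>)\<^sup>\<oplus>\<^bsub>?F\<^esub>"
    using F.pluss_left[OF F.unit_closed] F.unit_right F.unit_closed by simp
  then have unit: "\<e>\<^bsub>?F\<^esub> \<in> projections ?F" using F.unit_closed F.pluss_in_projections by metis
  interpret F: trunked_semigroup ?F X "FEM_gen X" "\<lambda>s. snd (h s)"
  proof
    show "carrier ?F \<subseteq> semigroup_span ?F (projections ?F \<union> FEM_gen X ` X)"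
    proof
      fix s assume "s \<in> carrier ?F"
      then show "s \<in> semigroup_span ?F (projections ?F \<union> FEM_gen X ` X)"
        by (induction rule: FEM_induct) (auto intro: semigroup_span.intros unit)
    qed
    show "is_hom ?F (trunk_algebra ?F ()) (\<lambda>s. (s, snd (h s)))"
      using F.is_hom_cong[OF h hs] by (simp add: is_hom_def trunk_algebra_def)
  qed (simp_all add: FEM_gen_carrier h_gen)
  show ?thesis by (rule F.proper)
qed

theorem proposition5p1:
  fixes X :: "'a set"
  shows "proper_semigroup (FEM X) \<and> proper_semigroup (FES X)"
  using proper_FEM proper_FES by blast

end
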